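(* Let $\mathcal{X}\subset\mathbb{R}^D$ be a finite set of nonzero points, $1\le d<D$, and $L_*$ a $d$-dimensional subspace; let $\mathcal{X}_{in}=\mathcal{X}\cap L_*$ with $n_1=|\mathcal{X}_{in}|\ge1$, $\mathcal{X}_{out}=\mathcal{X}\setminus\mathcal{X}_{in}$ with $n_0=|\mathcal{X}_{out}|$, and let $\Sigma_{in,*}\in S_{++}(d)$ be a TME solution of $\{U_{L_*}^\top x:x\in\mathcal{X}_{in}\}$ (assumed to exist). Let $\Sigma\in S_{++}(D)$ and suppose $\Sigma=\Sigma_1+\Sigma_2$ with $\Sigma_1,\Sigma_2$ positive semidefinite and $\operatorname{im}(\Sigma_1)\subseteq L_*$. Define $\Sigma_{+,in}=\sum_{x\in\mathcal{X}_{in}}\frac{xx^\top}{x^\top\Sigma^{-1}x}$, $\Sigma_{+,out}=\sum_{x\in\mathcal{X}_{out}}\frac{xx^\top}{x^\top\Sigma^{-1}x}$, $\Sigma_+=\Sigma_{+,in}+\Sigma_{+,out}$, and $h(M)=\sigma_d(\Sigma_{in,*}^{-1/2}U_{L_*}^\top MU_{L_*}\Sigma_{in,*}^{-1/2})$. Then: (i) $h(\Sigma_{+,in})\ge\frac{n_1}{d}h(\Sigma_1)$; (ii) $\Sigma_{+,out}\preceq\|U_{L_*^\perp}^\top\Sigma U_{L_*^\perp}\|\sum_{x\in\mathcal{X}_{out}}\frac{xx^\top}{\|U_{L_*^\perp}^\top x\|^2}$, and consequently $\|\Sigma_{+,out}\|\le\mathcal{A}\,\|U_{L_*^\perp}^\top\Sigma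 U_{L_*^\perp}\|$; (iii) $\operatorname{tr}(U_{L_*^\perp}^\top\Sigma_{+,out}U_{L_*^\perp})\le n_0\|U_{L_*^\perp}^\top\Sigma U_{L_*^\perp}\|$; (iv) $\Sigma_{+,out}\succeq\sigma_D(\Sigma)\sum_{x\in\mathcal{X}_{out}}\frac{xx^\top}{\|x\|^2}$ and $\Sigma_+\succeq\sigma_D(\Sigma)\sum_{x\in\mathcal{X}}\frac{xx^\top}{\|x\|^2}$.
   Context: $S_{++}(k)$ denotes symmetric positive definite $k\times k$ matrices; $\preceq$ is the Loewner order. $U_{L_*}\in\mathbb{R}^{D\times d}$ and $U_{L_*^\perp}\in\mathbb{R}^{D\times(D-d)}$ have orthonormal columns spanning $L_*$ and $L_*^\perp$. $\sigma_i(M)$ is the $i$-th largest eigenvalue of a symmetric matrix $M$; $\|\cdot\|$ is the spectral norm. A TME solution of a finite set $Y\subset\mathbb{R}^d$ with $|Y|=n_1$ is a minimizer over $\Sigma\in S_{++}(d)$ with $\operatorname{tr}\Sigma=d$ of $\frac{d}{n_1}\sum_{y\in Y}\log(y^\top\Sigma^{-1}y)+\log\det\Sigma$. $\mathcal{A}=\big\|\sum_{x\in\mathcal{X}_{out}}xx^\top/\|U_{L_*^\perp}^\top x\|^2\big\|$. *)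

theory Defs
  imports "HOL-Analysis.Analysis" "HOL-Library.Multiset"
begin

text \<open>Outer product x y^T.\<close>
definition outer :: "real^'n \<Rightarrow> real^'n \<Rightarrow> real^'n^'n" where
  "outer x y = (\<chi> i j. x $ i * y $ j)"

text \<open>Symmetric positive semidefinite / positive definite matrices.\<close>
definition psd :: "real^'n^'n \<Rightarrow> bool" where
  "psd A \<longleftrightarrow> transpose A = A \<and> (\<forall>x. 0 \<le> x \<bullet> (A *v x))"

definition pd :: "real^'n^'n \<Rightarrow> bool" where
  "pd A \<longleftrightarrow> transpose A = A \<and> (\<forall>x. x \<noteq> 0 \<longrightarrow> 0 < x \<bullet> (A *v x))"

text \<open>Loewner order: A \<preceq> B iff B - A is positive semidefinite.\<close>
definition loewner_le :: "real^'n^'n \<Rightarrow> real^'n^'n \<Rightarrow> bool" where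
  "loewner_le A B \<longleftrightarrow> psd (B - A)"

text \<open>Spectral norm (operator norm w.r.t. the Euclidean norms).\<close>
definition spec_norm :: "real^'n^'m \<Rightarrow> real" where
  "spec_norm A = onorm (\<lambda>x. A *v x)"

text \<open>Eigenvalues with (geometric) multiplicity, and sigma i A = i-th largest one (i \<ge> 1).\<close>
definition eigvals_mset :: "real^'n^'n \<Rightarrow> real multiset" where
  "eigvals_mset A = Abs_multiset (\<lambda>l. dim {v. A *v v = l *\<^sub>R v})"

definition sigma :: "nat \<Rightarrow> real^'n^'n \<Rightarrow> real" where
  "sigma i A = rev (sorted_list_of_multiset (eigvals_mset A)) ! (i - 1)"

text \<open>Principal (positive semidefinite) square root.\<close>
definition mat_sqrt :: "real^'n^'n \<Rightarrow> real^'n^'n" where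
  "mat_sqrt A = (THE B. psd B \<and> B ** B = A)"

text \<open>TME objective and TME solution of a finite set Y in R^d.\<close>
definition tme_obj :: "(real^'d) set \<Rightarrow> real^'d^'d \<Rightarrow> real" where
  "tme_obj Y S = (real CARD('d) / real (card Y)) * (\<Sum>y\<in>Y. ln (y \<bullet> (matrix_inv S *v y)))
                 + ln (det S)"

definition is_TME :: "(real^'d) set \<Rightarrow> real^'d^'d \<Rightarrow> bool" where
  "is_TME Y S \<longleftrightarrow> pd S \<and> trace S = real CARD('d) \<and>
     (\<forall>S'. pd S' \<and> trace S' = real CARD('d) \<longrightarrow> tme_obj Y S \<le> tme_obj Y S')"

end

theory Submission
  imports Defs
begin

text \<open>
  Everything rests on the variational formula \<open>x\<^sup>T S\<^sup>-\<^sup>1 x = max\<^sub>w (2 w\<^sup>T x - w\<^sup>T S w)\<close>,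
  attained at \<open>w = S\<^sup>-\<^sup>1 x\<close>. Evaluating it at a suitable \<open>w\<close>, or comparing \<open>\<Sigma>\<close> with a
  compression \<open>V S V\<^sup>T\<close> that it dominates, bounds every weight \<open>1 / (x\<^sup>T \<Sigma>\<^sup>-\<^sup>1 x)\<close> of the
  reweighted scatter matrix from above or below, and parts (ii)--(iv) follow weight by weight.
  For (i), \<open>\<Sigma> \<succeq> \<Sigma>\<^sub>1 \<succeq> h(\<Sigma>\<^sub>1) U \<Sigma>\<^sub>i\<^sub>n U\<^sup>T\<close>, so the inlier weights are at least
  \<open>h(\<Sigma>\<^sub>1) / (y\<^sup>T \<Sigma>\<^sub>i\<^sub>n\<^sup>-\<^sup>1 y)\<close> with \<open>y = U\<^sup>T x\<close>. It remains to see that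
  \<open>\<Sum>\<^sub>y y y\<^sup>T / (y\<^sup>T \<Sigma>\<^sub>i\<^sub>n\<^sup>-\<^sup>1 y) \<succeq> (n\<^sub>1/d) \<Sigma>\<^sub>i\<^sub>n\<close> at a TME solution: a rank-one downdate of
  \<open>\<Sigma>\<^sub>i\<^sub>n\<close> along \<open>\<Sigma>\<^sub>i\<^sub>n b\<close> cannot decrease the TME objective, and letting the downdate vanish
  gives this first-order condition.
\<close>

lemma inner_mulv_transpose: "(x::real^'m) \<bullet> ((A::real^'n^'m) *v y) = (transpose A *v x) \<bullet> y"
  by (simp add: dot_lmul_matrix)

lemma inner_transpose_mulv: "(x::real^'n) \<bullet> (transpose (B::real^'n^'m) *v y) = (B *v x) \<bullet> y"
  using inner_mulv_transpose[of x "transpose B" y] by simp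

lemma symmetric_inner_mulv: "transpose A = A \<Longrightarrow> x \<bullet> (A *v y) = (A *v x) \<bullet> (y::real^'n)"
  by (metis inner_mulv_transpose)

lemma quad_form_congruence: "g \<bullet> ((transpose B ** A ** B) *v g) = (B *v g) \<bullet> (A *v (B *v g))"
  for B :: "real^'k^'n" and A :: "real^'n^'n"
  by (simp only: matrix_vector_mul_assoc[symmetric] inner_transpose_mulv)

lemma transpose_diff: "transpose (A - B) = transpose A - transpose (B::real^'n^'m)"
  by (simp add: transpose_def vec_eq_iff)

lemma transpose_sum: "transpose (\<Sum>i\<in>S. f i) = (\<Sum>i\<in>S. transpose (f i))"
  for f :: "'a \<Rightarrow> real^'n^'m"
  by (induction S rule: infinite_finite_induct) (auto simp: transpose_def vec_eq_iff)

lemma matrix_diff_ldistrib: "(A::real^'n^'m) ** (B - C) = A ** B - A ** C"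
  by (simp add: matrix_matrix_mult_def vec_eq_iff sum_subtractf right_diff_distrib)

lemma matrix_diff_rdistrib: "(B - C) ** (A::real^'p^'n) = B ** A - C ** A" for B C :: "real^'n^'m"
  by (simp add: matrix_matrix_mult_def vec_eq_iff sum_subtractf left_diff_distrib)

lemma sum_matrix_mul: "(\<Sum>i\<in>S. f i) ** (B::real^'p^'n) = (\<Sum>i\<in>S. f i ** B)"
  for f :: "'a \<Rightarrow> real^'n^'m"
  by (induction S rule: infinite_finite_induct)
    (auto simp: matrix_matrix_mult_def vec_eq_iff sum.distrib distrib_right)

lemma matrix_mul_sum: "(B::real^'m^'p) ** (\<Sum>i\<in>S. f i) = (\<Sum>i\<in>S. B ** f i)"
  for f :: "'a \<Rightarrow> real^'n^'m"
  by (induction S rule: infinite_finite_induct) (auto simp: matrix_add_ldistrib)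

lemma sum_matrix_vector_mult: "(\<Sum>i\<in>S. f i) *v (w::real^'n) = (\<Sum>i\<in>S. f i *v w)"
  for f :: "'a \<Rightarrow> real^'n^'m"
  by (induction S rule: infinite_finite_induct) (auto simp: matrix_vector_mult_add_rdistrib)

lemma trace_sum: "trace (\<Sum>i\<in>S. f i) = (\<Sum>i\<in>S. trace (f i))"
  for f :: "'a \<Rightarrow> real^'n^'n"
proof (induction S rule: infinite_finite_induct)
  case (insert x F)
  then show ?case by (simp add: trace_add)
qed (auto simp: trace_def)

lemma trace_scaleR: "trace (c *\<^sub>R A) = c * trace (A::real^'n^'n)"
  by (simp add: trace_def sum_distrib_left)

lemma det_scaleR: "det (c *\<^sub>R A) = c ^ CARD('n) * det (A::real^'n^'n)"
proof -
  have "det (c *\<^sub>R mat 1 :: real^'n^'n) = c ^ CARD('n)"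
    by (subst det_diagonal) (auto simp: mat_def)
  moreover have "c *\<^sub>R A = (c *\<^sub>R mat 1) ** A" by (simp add: scalar_matrix_assoc[symmetric])
  ultimately show ?thesis by (simp add: det_mul)
qed

lemma matrix_eq_on_spanning:
  fixes M N :: "real^'n^'m"
  assumes "\<And>b. b \<in> B \<Longrightarrow> M *v b = N *v b" and "span B = UNIV"
  shows "M = N"
  using linear_eq_on_span[of "(*v) M" "(*v) N" B] assms by (auto simp: matrix_eq)

lemma outer_mulv: "outer x y *v w = (y \<bullet> w) *\<^sub>R (x::real^'n)"
  by (simp add: outer_def matrix_vector_mult_def inner_vec_def vec_eq_iff sum_distrib_left algebra_simps)

lemma transpose_outer: "transpose (outer x y) = outer y (x::real^'n)"
  by (simp add: outer_def transpose_def vec_eq_iff)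

lemma outer_congruence:
  "transpose (B::real^'m^'n) ** outer x y ** B = outer (transpose B *v x) (transpose B *v y)"
  unfolding outer_def matrix_matrix_mult_def matrix_vector_mult_def transpose_def
  by (simp add: vec_eq_iff sum_distrib_left sum_distrib_right mult.assoc mult.commute mult.left_commute)

lemma trace_outer: "trace (outer x x) = x \<bullet> (x::real^'n)"
  by (simp add: trace_def outer_def inner_vec_def)

lemma nonneg_quadratic_discriminant:
  fixes a b g :: real
  assumes g: "0 \<le> g" and q: "\<And>t. 0 \<le> a + 2 * t * b + t\<^sup>2 * g"
  shows "b\<^sup>2 \<le> a * g"
proof (cases "g = 0")
  case True
  have "b = 0"
  proof (rule ccontr)
    assume "b \<noteq> 0"
    have "0 \<le> a + 2 * (- (a + 1) / (2 * b)) * b + (- (a + 1) / (2 * b))\<^sup>2 * g" by (rule q)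
    also have "\<dots> = -1" using True \<open>b \<noteq> 0\<close> by (simp add: field_simps)
    finally show False by simp
  qed
  then show ?thesis using True by simp
next
  case False
  then have gp: "0 < g" using g by simp
  have "0 \<le> a + 2 * (- b / g) * b + (- b / g)\<^sup>2 * g" by (rule q)
  also have "\<dots> = a - b\<^sup>2 / g" using gp by (simp add: field_simps power2_eq_square)
  finally show ?thesis using gp by (simp add: field_simps)
qed

section \<open>Weighted scatter matrices\<close>

definition scatter_matrix :: "(real^'n \<Rightarrow> real) \<Rightarrow> (real^'n) set \<Rightarrow> real^'n^'n" where
  "scatter_matrix w S = (\<Sum>x\<in>S. w x *\<^sub>R outer x x)"

lemma quad_scatter_matrix: "v \<bullet> (scatter_matrix w S *v v) = (\<Sum>x\<in>S. w x * (v \<bullet> x)\<^sup>2)"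
  unfolding scatter_matrix_def
  by (simp add: sum_matrix_vector_mult scaleR_matrix_vector_assoc[symmetric] outer_mulv inner_sum_right
      power2_eq_square inner_commute mult.assoc)

lemma transpose_scatter_matrix: "transpose (scatter_matrix w S) = scatter_matrix w S"
  unfolding scatter_matrix_def by (simp add: transpose_sum transpose_scalar transpose_outer)

lemma psd_scatter_matrix: "(\<And>x. x \<in> S \<Longrightarrow> 0 \<le> w x) \<Longrightarrow> psd (scatter_matrix w S)"
  unfolding psd_def transpose_scatter_matrix quad_scatter_matrix by (simp add: sum_nonneg)

lemma scaleR_scatter_matrix: "c *\<^sub>R scatter_matrix w S = scatter_matrix (\<lambda>x. c * w x) S"
  unfolding scatter_matrix_def by (simp add: scaleR_sum_right)

lemma scatter_matrix_mono:
  assumes "\<And>x. x \<in> S \<Longrightarrow> v x \<le> w x"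
  shows "loewner_le (scatter_matrix v S) (scatter_matrix w S)"
proof -
  have "scatter_matrix w S - scatter_matrix v S = scatter_matrix (\<lambda>x. w x - v x) S"
    unfolding scatter_matrix_def by (simp add: sum_subtractf scaleR_diff_left)
  then show ?thesis unfolding loewner_le_def using assms by (simp add: psd_scatter_matrix)
qed

lemma scatter_matrix_union:
  "finite A \<Longrightarrow> finite B \<Longrightarrow> A \<inter> B = {} \<Longrightarrow>
    scatter_matrix w (A \<union> B) = scatter_matrix w A + scatter_matrix w B"
  unfolding scatter_matrix_def by (rule sum.union_disjoint)

lemma trace_congruence_scatter_matrix:
  "trace (transpose (B::real^'m^'n) ** scatter_matrix w S ** B)
    = (\<Sum>x\<in>S. w x * (norm (transpose B *v x))\<^sup>2)"
  unfolding scatter_matrix_def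
  by (simp add: matrix_mul_sum sum_matrix_mul trace_sum trace_scaleR outer_congruence trace_outer
      matrix_scalar_ac scalar_matrix_assoc[symmetric] power2_norm_eq_inner)

lemma quad_congruence_scatter_matrix:
  "w \<bullet> ((transpose (B::real^'m^'n) ** scatter_matrix g S ** B) *v w)
    = (\<Sum>x\<in>S. g x * ((B *v w) \<bullet> x)\<^sup>2)"
  unfolding quad_form_congruence quad_scatter_matrix ..

lemma scatter_matrix_orthonormal_mulv:
  assumes fin: "finite B" and orth: "pairwise orthogonal B" and unit: "\<forall>b\<in>B. norm b = 1" and c: "c \<in> B"
  shows "scatter_matrix w B *v c = w c *\<^sub>R c"
proof -
  have "b \<bullet> c = (if b = c then 1 else 0)" if "b \<in> B" for b
    using orth unit that c unfolding pairwise_def orthogonal_def by (auto simp: norm_eq_1)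
  then have "scatter_matrix w B *v c = (\<Sum>b\<in>B. if b = c then w c *\<^sub>R c else 0)"
    unfolding scatter_matrix_def
    by (auto simp: sum_matrix_vector_mult scaleR_matrix_vector_assoc[symmetric] outer_mulv intro!: sum.cong)
  then show ?thesis using fin c by simp
qed

section \<open>Positive definite matrices and the spectral norm\<close>

lemma pd_imp_psd: "pd A \<Longrightarrow> psd A"
  unfolding pd_def psd_def by (metis inner_zero_left matrix_vector_mult_0_right order.refl less_imp_le)

lemma psd_cauchy_schwarz:
  fixes P :: "real^'n^'n"
  assumes P: "psd P"
  shows "(u \<bullet> (P *v v))\<^sup>2 \<le> (u \<bullet> (P *v u)) * (v \<bullet> (P *v v))"
proof (rule nonneg_quadratic_discriminant)
  show "0 \<le> v \<bullet> (P *v v)" using P unfolding psd_def by simp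
  have vu: "v \<bullet> (P *v u) = u \<bullet> (P *v v)"
    using P symmetric_inner_mulv[of P v u] unfolding psd_def by (simp add: inner_commute)
  fix t
  have "0 \<le> (u + t *\<^sub>R v) \<bullet> (P *v (u + t *\<^sub>R v))" using P unfolding psd_def by simp
  also have "\<dots> = u \<bullet> (P *v u) + 2 * t * (u \<bullet> (P *v v)) + t\<^sup>2 * (v \<bullet> (P *v v))"
    using vu by (simp add: matrix_vector_right_distrib matrix_vector_mult_scaleR inner_add_left
        inner_add_right power2_eq_square algebra_simps)
  finally show "0 \<le> u \<bullet> (P *v u) + 2 * t * (u \<bullet> (P *v v)) + t\<^sup>2 * (v \<bullet> (P *v v))" .
qed

lemma spec_norm_nonneg: "0 \<le> spec_norm (A::real^'n^'m)"
  unfolding spec_norm_def by (rule onorm_pos_le) (rule matrix_vector_mul_bounded_linear)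

lemma quad_le_spec_norm: "x \<bullet> (A *v x) \<le> spec_norm A * (x \<bullet> x)" for A :: "real^'n^'n"
proof -
  have "x \<bullet> (A *v x) \<le> norm x * norm (A *v x)" by (rule norm_cauchy_schwarz)
  also have "\<dots> \<le> norm x * (spec_norm A * norm x)"
    unfolding spec_norm_def by (rule mult_left_mono) (auto intro: onorm matrix_vector_mul_bounded_linear)
  finally show ?thesis by (simp add: power2_norm_eq_inner[symmetric] power2_eq_square mult_ac)
qed

lemma spec_norm_le_of_quad:
  fixes P :: "real^'n^'n"
  assumes P: "psd P" and bound: "\<And>x. x \<bullet> (P *v x) \<le> c * (x \<bullet> x)" and c: "0 \<le> c"
  shows "spec_norm P \<le> c"
  unfolding spec_norm_def
proof (rule onorm_le)
  fix v :: "real^'n"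
  define u where "u = P *v v"
  have "(u \<bullet> u)\<^sup>2 \<le> (u \<bullet> (P *v u)) * (v \<bullet> (P *v v))"
    using psd_cauchy_schwarz[OF P, of u v] unfolding u_def by simp
  also have "\<dots> \<le> (c * (u \<bullet> u)) * (c * (v \<bullet> v))"
    using P bound c unfolding psd_def by (intro mult_mono) auto
  finally have "u \<bullet> u \<le> c\<^sup>2 * (v \<bullet> v)"
    using c by (cases "u \<bullet> u = 0") (auto simp: power2_eq_square algebra_simps mult_le_cancel_right)
  then have "(norm u)\<^sup>2 \<le> (c * norm v)\<^sup>2" by (simp add: power2_norm_eq_inner power_mult_distrib)
  then show "norm (P *v v) \<le> c * norm v" unfolding u_def[symmetric]
    using c by (simp add: power2_le_iff_abs_le)
qed

lemma spec_norm_mono: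
  fixes P Q :: "real^'n^'n"
  assumes "psd P" and "loewner_le P Q"
  shows "spec_norm P \<le> spec_norm Q"
proof (rule spec_norm_le_of_quad[OF \<open>psd P\<close> _ spec_norm_nonneg])
  fix x
  have "x \<bullet> (P *v x) \<le> x \<bullet> (Q *v x)"
    using \<open>loewner_le P Q\<close> unfolding loewner_le_def psd_def
    by (simp add: matrix_vector_mult_diff_rdistrib inner_diff_right)
  also have "\<dots> \<le> spec_norm Q * (x \<bullet> x)" by (rule quad_le_spec_norm)
  finally show "x \<bullet> (P *v x) \<le> spec_norm Q * (x \<bullet> x)" .
qed

lemma spec_norm_scaleR: "spec_norm (c *\<^sub>R A) = \<bar>c\<bar> * spec_norm (A::real^'n^'m)"
  unfolding spec_norm_def scaleR_matrix_vector_assoc[symmetric]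
  by (rule onorm_scaleR) (rule matrix_vector_mul_bounded_linear)

lemma matrix_inv_right: "invertible A \<Longrightarrow> A ** matrix_inv A = mat 1"
  and matrix_inv_left: "invertible A \<Longrightarrow> matrix_inv A ** A = mat 1"
  for A :: "real^'n^'n"
  unfolding invertible_def matrix_inv_def by (metis (mono_tags, lifting) someI_ex)+

lemma matrix_inv_unique:
  fixes A B :: "real^'n^'n"
  assumes "A ** B = mat 1"
  shows "matrix_inv A = B"
proof -
  have inv: "invertible A" using assms invertible_right_inverse by blast
  have "matrix_inv A = (matrix_inv A ** A) ** B" using assms by (simp add: matrix_mul_assoc[symmetric])
  then show ?thesis using matrix_inv_left[OF inv] by simp
qed

lemma matrix_inv_scaleR:
  fixes A :: "real^'n^'n"
  assumes "invertible A" and "c \<noteq> 0"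
  shows "matrix_inv (c *\<^sub>R A) = (1 / c) *\<^sub>R matrix_inv A"
  by (rule matrix_inv_unique)
    (use assms matrix_inv_right in \<open>simp add: matrix_scalar_ac scalar_matrix_assoc[symmetric]\<close>)

lemma pd_invertible:
  fixes A :: "real^'n^'n"
  assumes "pd A"
  shows "invertible A"
proof -
  have "inj ((*v) A)"
  proof (rule injI)
    fix x y assume "A *v x = A *v y"
    then have "(x - y) \<bullet> (A *v (x - y)) = 0" by (simp add: matrix_vector_mult_diff_distrib)
    then show "x = y" using assms unfolding pd_def by (metis less_irrefl right_minus_eq)
  qed
  then show ?thesis using matrix_left_invertible_injective invertible_left_inverse by blast
qed

lemma pd_matrix_inv_mulv: "pd A \<Longrightarrow> A *v (matrix_inv A *v x) = x"
  by (simp add: matrix_vector_mul_assoc matrix_inv_right pd_invertible)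

lemma inv_quad_pos:
  fixes S :: "real^'n^'n"
  assumes "pd S" and "y \<noteq> 0"
  shows "0 < y \<bullet> (matrix_inv S *v y)"
proof -
  define p where "p = matrix_inv S *v y"
  have Sp: "S *v p = y" unfolding p_def by (rule pd_matrix_inv_mulv[OF assms(1)])
  then have "p \<noteq> 0" using assms(2) by auto
  then have "0 < p \<bullet> (S *v p)" using assms(1) unfolding pd_def by blast
  then have "0 < p \<bullet> y" using Sp by simp
  then show ?thesis unfolding p_def by (simp add: inner_commute)
qed

lemma symmetric_matrix_inv:
  fixes S :: "real^'n^'n"
  assumes "pd S"
  shows "transpose (matrix_inv S) = matrix_inv S"
proof -
  have "S ** transpose (matrix_inv S) = transpose (matrix_inv S ** S)"
    using assms unfolding pd_def by (simp add: matrix_transpose_mul)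
  also have "\<dots> = mat 1" using matrix_inv_left[OF pd_invertible[OF assms]] by simp
  finally show ?thesis using matrix_inv_unique by metis
qed

lemma psd_matrix_inv: "pd S \<Longrightarrow> psd (matrix_inv S)"
  unfolding psd_def using symmetric_matrix_inv inv_quad_pos
  by (metis inner_zero_left less_eq_real_def order.refl)

lemma inv_quad_nonneg: "pd S \<Longrightarrow> 0 \<le> y \<bullet> (matrix_inv S *v y)"
  using psd_matrix_inv unfolding psd_def by blast

lemma pd_scaleR: "pd S \<Longrightarrow> 0 < c \<Longrightarrow> pd (c *\<^sub>R S)"
  unfolding pd_def by (simp add: transpose_scalar scaleR_matrix_vector_assoc[symmetric])

lemma pd_trace_pos:
  fixes A :: "real^'n^'n"
  assumes "pd A"
  shows "0 < trace A"
proof -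
  have "A $ i $ i = axis i 1 \<bullet> (A *v axis i 1)" for i
    by (simp add: matrix_vector_mult_basis inner_commute[of "axis i 1"] inner_axis column_def)
  moreover have "0 < axis i 1 \<bullet> (A *v axis i (1::real))" for i
    using assms unfolding pd_def by (simp add: axis_eq_0_iff)
  ultimately show ?thesis unfolding trace_def by (intro sum_pos) auto
qed

lemma inv_quad_variational:
  fixes S :: "real^'n^'n"
  assumes pd: "pd S"
  shows "2 * (w \<bullet> x) - w \<bullet> (S *v w) \<le> x \<bullet> (matrix_inv S *v x)"
proof -
  define p where "p = matrix_inv S *v x"
  have Sp: "S *v p = x" unfolding p_def by (rule pd_matrix_inv_mulv[OF pd])
  have sym: "transpose S = S" using pd unfolding pd_def by simp
  have "0 \<le> (w - p) \<bullet> (S *v (w - p))"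
    using pd unfolding pd_def by (cases "w - p = 0") (auto intro: less_imp_le)
  also have "\<dots> = w \<bullet> (S *v w) - 2 * (w \<bullet> x) + p \<bullet> x"
    using Sp symmetric_inner_mulv[OF sym, of p w]
    by (simp add: matrix_vector_mult_diff_distrib inner_diff_left inner_diff_right inner_commute)
  finally show ?thesis unfolding p_def[symmetric] by (simp add: inner_commute)
qed

lemma inv_quad_compression_le:
  fixes V :: "real^'d^'D" and Sig :: "real^'D^'D" and S :: "real^'d^'d"
  assumes pd: "pd Sig" and pdS: "pd S"
    and dom: "\<And>p. (transpose V *v p) \<bullet> (S *v (transpose V *v p)) \<le> p \<bullet> (Sig *v p)"
  shows "(V *v y) \<bullet> (matrix_inv Sig *v (V *v y)) \<le> y \<bullet> (matrix_inv S *v y)"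
proof -
  define p where "p = matrix_inv Sig *v (V *v y)"
  have "(V *v y) \<bullet> (matrix_inv Sig *v (V *v y)) = 2 * (p \<bullet> (V *v y)) - p \<bullet> (Sig *v p)"
    unfolding p_def pd_matrix_inv_mulv[OF pd] by (simp add: inner_commute)
  also have "\<dots> \<le> 2 * ((transpose V *v p) \<bullet> y) - (transpose V *v p) \<bullet> (S *v (transpose V *v p))"
    using dom[of p] by (simp add: inner_mulv_transpose)
  also have "\<dots> \<le> y \<bullet> (matrix_inv S *v y)" by (rule inv_quad_variational[OF pdS])
  finally show ?thesis .
qed

lemma inv_quad_compression_ge:
  fixes V :: "real^'k^'D" and Sig :: "real^'D^'D"
  assumes pd: "pd Sig" and c: "0 < c"
    and dom: "\<And>a. (V *v a) \<bullet> (Sig *v (V *v a)) \<le> c * (a \<bullet> a)"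
  shows "(transpose V *v x) \<bullet> (transpose V *v x) \<le> c * (x \<bullet> (matrix_inv Sig *v x))"
proof -
  define g where "g = transpose V *v x"
  define w where "w = V *v ((1 / c) *\<^sub>R g)"
  have "w \<bullet> x = ((1 / c) *\<^sub>R g) \<bullet> g"
    unfolding w_def g_def by (simp only: inner_transpose_mulv[symmetric])
  then have "w \<bullet> x = (g \<bullet> g) / c" by simp
  moreover have "w \<bullet> (Sig *v w) \<le> (g \<bullet> g) / c"
    using dom[of "(1 / c) *\<^sub>R g"] c unfolding w_def by (simp add: power2_eq_square field_simps)
  ultimately have "(g \<bullet> g) / c \<le> x \<bullet> (matrix_inv Sig *v x)"
    using inv_quad_variational[OF pd, of w x] by linarith
  then show ?thesis unfolding g_def[symmetric] using c by (simp add: field_simps)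
qed

section \<open>Spectral theory of symmetric matrices\<close>

definition eigenvalues :: "real^'n^'n \<Rightarrow> real set" where
  "eigenvalues A = {l. \<exists>v. v \<noteq> 0 \<and> A *v v = l *\<^sub>R v}"

abbreviation eigenspace :: "real^'n^'n \<Rightarrow> real \<Rightarrow> (real^'n) set" where
  "eigenspace A l \<equiv> {v. A *v v = l *\<^sub>R v}"

lemma subspace_eigenspace: "subspace (eigenspace A l)"
  unfolding subspace_def by (simp add: matrix_vector_right_distrib matrix_vector_mult_scaleR scaleR_add_right)

lemma eigenspace_inter: "l \<noteq> m \<Longrightarrow> eigenspace A l \<inter> eigenspace A m = {0}"
  by (auto simp: scaleR_cancel_right)

lemma rayleigh_minimizer_eigenvector:
  fixes A :: "real^'n^'n"
  assumes sym: "transpose A = A" and W: "subspace W" and inv: "\<And>x. x \<in> W \<Longrightarrow> A *v x \<in> W"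
    and v: "v \<in> W" "v \<bullet> v = 1"
    and min: "\<And>x. x \<in> W \<Longrightarrow> (v \<bullet> (A *v v)) * (x \<bullet> x) \<le> x \<bullet> (A *v x)"
  shows "A *v v = (v \<bullet> (A *v v)) *\<^sub>R v"
proof -
  define \<mu> where "\<mu> = v \<bullet> (A *v v)"
  define u where "u = A *v v - \<mu> *\<^sub>R v"
  have uW: "u \<in> W" unfolding u_def using inv v W by (simp add: subspace_diff subspace_scale)
  have uv: "u \<bullet> v = 0"
    using v(2) unfolding u_def \<mu>_def by (simp add: inner_diff_left inner_commute[of "A *v v"])
  have Av: "A *v v = u + \<mu> *\<^sub>R v" unfolding u_def by simp
  have uAv: "u \<bullet> (A *v v) = u \<bullet> u" unfolding Av using uv by (simp add: inner_add_right)
  have vAu: "v \<bullet> (A *v u) = u \<bullet> u"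
    using symmetric_inner_mulv[OF sym, of v u] uAv by (simp add: inner_commute)
  have "(u \<bullet> u)\<^sup>2 \<le> 0 * (u \<bullet> (A *v u) - \<mu> * (u \<bullet> u))"
  proof (rule nonneg_quadratic_discriminant)
    show "0 \<le> u \<bullet> (A *v u) - \<mu> * (u \<bullet> u)" using min[OF uW] unfolding \<mu>_def by simp
    fix t
    have x: "v + t *\<^sub>R u \<in> W" using v uW W by (simp add: subspace_add subspace_scale)
    have "(v + t *\<^sub>R u) \<bullet> (v + t *\<^sub>R u) = 1 + t\<^sup>2 * (u \<bullet> u)"
      using v(2) uv by (simp add: inner_add_left inner_add_right inner_commute power2_eq_square)
    moreover have "(v + t *\<^sub>R u) \<bullet> (A *v (v + t *\<^sub>R u)) = \<mu> + 2 * t * (u \<bullet> u) + t\<^sup>2 * (u \<bullet> (A *v u))"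
      using uAv vAu unfolding \<mu>_def
      by (simp add: matrix_vector_right_distrib matrix_vector_mult_scaleR inner_add_left
          inner_add_right power2_eq_square algebra_simps)
    ultimately show "0 \<le> 0 + 2 * t * (u \<bullet> u) + t\<^sup>2 * (u \<bullet> (A *v u) - \<mu> * (u \<bullet> u))"
      using min[OF x] unfolding \<mu>_def by (simp add: algebra_simps)
  qed
  then have "u = 0" by simp
  then show ?thesis unfolding u_def \<mu>_def by simp
qed

lemma symmetric_min_eigenvector:
  fixes A :: "real^'n^'n"
  assumes sym: "transpose A = A" and W: "subspace W" and inv: "\<And>x. x \<in> W \<Longrightarrow> A *v x \<in> W"
    and ne: "W \<noteq> {0}"
  obtains v \<mu> where "v \<in> W" "norm v = 1" "A *v v = \<mu> *\<^sub>R v"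
    "\<forall>x\<in>W. \<mu> * (x \<bullet> x) \<le> x \<bullet> (A *v x)"
proof -
  define K where "K = W \<inter> sphere 0 1"
  have normalize: "x /\<^sub>R norm x \<in> K" if "x \<in> W" "x \<noteq> 0" for x
    unfolding K_def using that W by (simp add: subspace_scale)
  have "compact K" unfolding K_def by (rule closed_Int_compact[OF closed_subspace[OF W] compact_sphere])
  obtain w where "w \<in> W" "w \<noteq> 0" using ne W subspace_0 by blast
  then have "K \<noteq> {}" using normalize by blast
  have "continuous_on K (\<lambda>x. x \<bullet> (A *v x))"
    by (intro continuous_intros linear_continuous_on matrix_vector_mul_bounded_linear)
  then obtain v where v: "v \<in> K" and vmin: "\<And>y. y \<in> K \<Longrightarrow> v \<bullet> (A *v v) \<le> y \<bullet> (A *v y)"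
    using continuous_attains_inf[OF \<open>compact K\<close> \<open>K \<noteq> {}\<close>] by blast
  have vW: "v \<in> W" and nv: "norm v = 1" using v K_def by auto
  have rq: "(v \<bullet> (A *v v)) * (x \<bullet> x) \<le> x \<bullet> (A *v x)" if "x \<in> W" for x
  proof (cases "x = 0")
    case False
    have "v \<bullet> (A *v v) \<le> (x /\<^sub>R norm x) \<bullet> (A *v (x /\<^sub>R norm x))"
      using vmin normalize[OF that False] by blast
    also have "\<dots> = (x \<bullet> (A *v x)) / (norm x)\<^sup>2"
      by (simp add: matrix_vector_mult_scaleR power2_eq_square divide_inverse)
    finally show ?thesis using False by (simp add: pos_le_divide_eq power2_norm_eq_inner)
  qed simp
  have "A *v v = (v \<bullet> (A *v v)) *\<^sub>R v"
    by (rule rayleigh_minimizer_eigenvector[OF sym W inv vW _ rq]) (use nv in \<open>simp_all add: norm_eq_1\<close>)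
  with that vW nv rq show ?thesis by blast
qed

lemma eigenvectors_orthogonal:
  fixes A :: "real^'n^'n"
  assumes sym: "transpose A = A" and "A *v u = l *\<^sub>R u" "A *v v = m *\<^sub>R v" "l \<noteq> m"
  shows "u \<bullet> v = 0"
proof -
  have "l * (u \<bullet> v) = (A *v u) \<bullet> v" using assms by simp
  also have "\<dots> = m * (u \<bullet> v)" using assms symmetric_inner_mulv[OF sym, of u v] by simp
  finally show ?thesis using assms(4) by simp
qed

lemma finite_eigenvalues:
  fixes A :: "real^'n^'n"
  assumes sym: "transpose A = A"
  shows "finite (eigenvalues A)"
proof -
  define f where "f l = (SOME v. v \<noteq> 0 \<and> A *v v = l *\<^sub>R v)" for l
  have f: "f l \<noteq> 0" "A *v f l = l *\<^sub>R f l" if "l \<in> eigenvalues A" for l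
  proof -
    have "\<exists>v. v \<noteq> 0 \<and> A *v v = l *\<^sub>R v" using that unfolding eigenvalues_def by blast
    then have "f l \<noteq> 0 \<and> A *v f l = l *\<^sub>R f l" unfolding f_def by (rule someI_ex)
    then show "f l \<noteq> 0" "A *v f l = l *\<^sub>R f l" by auto
  qed
  have inj: "inj_on f (eigenvalues A)"
  proof (rule inj_onI)
    fix l m assume l: "l \<in> eigenvalues A" and m: "m \<in> eigenvalues A" and "f l = f m"
    have "l *\<^sub>R f l = A *v f l" using f(2)[OF l] by simp
    also have "\<dots> = m *\<^sub>R f l" using f(2)[OF m] \<open>f l = f m\<close> by simp
    finally show "l = m" using f(1)[OF l] by simp
  qed
  have "pairwise orthogonal (f ` eigenvalues A)"
    unfolding pairwise_def orthogonal_def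
  proof clarify
    fix l m assume l: "l \<in> eigenvalues A" and m: "m \<in> eigenvalues A" and "f l \<noteq> f m"
    then have "l \<noteq> m" by auto
    then show "f l \<bullet> f m = 0" by (rule eigenvectors_orthogonal[OF sym f(2)[OF l] f(2)[OF m]])
  qed
  moreover have "0 \<notin> f ` eigenvalues A" using f(1) by auto
  ultimately have "independent (f ` eigenvalues A)" by (rule pairwise_orthogonal_independent)
  then have "finite (f ` eigenvalues A)" by (rule finiteI_independent)
  then show ?thesis using inj by (rule finite_imageD)
qed

lemma span_eigenspaces_symmetric:
  fixes A :: "real^'n^'n"
  assumes sym: "transpose A = A"
  shows "span (\<Union>l\<in>eigenvalues A. eigenspace A l) = UNIV"
proof -
  define S where "S = span (\<Union>l\<in>eigenvalues A. eigenspace A l)"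
  have "A *v x \<in> S" if "l \<in> eigenvalues A" "x \<in> eigenspace A l" for l x
  proof -
    have "l *\<^sub>R x \<in> S" unfolding S_def using that by (intro span_scale span_base) blast
    then show ?thesis using that by simp
  qed
  then have "(*v) A ` (\<Union>l\<in>eigenvalues A. eigenspace A l) \<subseteq> S" by blast
  then have "span ((*v) A ` (\<Union>l\<in>eigenvalues A. eigenspace A l)) \<subseteq> S"
    by (rule span_minimal) (simp add: S_def)
  then have "(*v) A ` S \<subseteq> S"
    unfolding S_def by (simp add: span_linear_image)
  then have AW: "A *v x \<in> orthogonal_comp S" if "x \<in> orthogonal_comp S" for x
    unfolding orthogonal_comp_def orthogonal_def
  proof clarify
    fix y assume "y \<in> S"
    then have "A *v y \<in> S" using \<open>(*v) A ` S \<subseteq> S\<close> by blast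
    then have "(A *v y) \<bullet> x = 0" using that unfolding orthogonal_comp_def orthogonal_def by blast
    then show "y \<bullet> (A *v x) = 0" using symmetric_inner_mulv[OF sym, of y x] by simp
  qed
  have "orthogonal_comp S = {0}"
  proof (rule ccontr)
    assume "orthogonal_comp S \<noteq> {0}"
    then obtain v \<mu> where v: "v \<in> orthogonal_comp S" "norm v = 1" "A *v v = \<mu> *\<^sub>R v"
      using symmetric_min_eigenvector[OF sym subspace_orthogonal_comp AW] by metis
    have "\<mu> \<in> eigenvalues A" unfolding eigenvalues_def using v by (intro CollectI exI[of _ v]) auto
    then have "v \<in> S" unfolding S_def using v(3) by (intro span_base) blast
    with v(1) have "v \<bullet> v = 0" unfolding orthogonal_comp_def orthogonal_def by blast
    with v(2) show False by simp
  qed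
  have "S = orthogonal_comp (orthogonal_comp S)" unfolding S_def by (simp add: orthogonal_comp_self)
  also have "\<dots> = UNIV" using \<open>orthogonal_comp S = {0}\<close> by (auto simp: orthogonal_comp_def orthogonal_def)
  finally show ?thesis unfolding S_def .
qed

lemma orthonormal_bases_family:
  fixes S :: "'i \<Rightarrow> 'a::euclidean_space set"
  assumes "\<And>i. subspace (S i)"
  obtains B where "\<forall>i. B i \<subseteq> S i \<and> pairwise orthogonal (B i) \<and> (\<forall>x\<in>B i. norm x = 1) \<and>
    independent (B i) \<and> card (B i) = dim (S i) \<and> span (B i) = S i"
proof -
  have "\<exists>B. B \<subseteq> S i \<and> pairwise orthogonal B \<and> (\<forall>x\<in>B. norm x = 1) \<and>
      independent B \<and> card B = dim (S i) \<and> span B = S i" for i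
  proof -
    obtain B where "B \<subseteq> S i" "pairwise orthogonal B" "\<And>x. x \<in> B \<Longrightarrow> norm x = 1"
      "independent B" "card B = dim (S i)" "span B = S i"
      using orthonormal_basis_subspace[OF assms] by blast
    then show ?thesis by blast
  qed
  then have "\<forall>i. \<exists>B. B \<subseteq> S i \<and> pairwise orthogonal B \<and> (\<forall>x\<in>B. norm x = 1) \<and>
      independent B \<and> card B = dim (S i) \<and> span B = S i" by blast
  from choice[OF this] show ?thesis using that by blast
qed

lemma pairwise_orthogonal_eigenbases_union:
  fixes A :: "real^'n^'n"
  assumes sym: "transpose A = A" and sub: "\<And>l. Bs l \<subseteq> eigenspace A l"
    and orth: "\<And>l. pairwise orthogonal (Bs l)"
  shows "pairwise orthogonal (\<Union>l\<in>E. Bs l)"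
  unfolding pairwise_def
proof clarify
  fix l m x y assume x: "x \<in> Bs l" and y: "y \<in> Bs m" and "x \<noteq> y"
  show "orthogonal x y"
  proof (cases "l = m")
    case True
    then show ?thesis using orth[of l] x y \<open>x \<noteq> y\<close> unfolding pairwise_def by auto
  next
    case False
    have "A *v x = l *\<^sub>R x" "A *v y = m *\<^sub>R y" using sub x y by auto
    with False show ?thesis unfolding orthogonal_def by (intro eigenvectors_orthogonal[OF sym])
  qed
qed

lemma symmetric_orthonormal_eigenbasis:
  fixes A :: "real^'n^'n"
  assumes sym: "transpose A = A"
  obtains B where "pairwise orthogonal B" "\<forall>b\<in>B. norm b = 1"
    "\<forall>b\<in>B. A *v b = (b \<bullet> (A *v b)) *\<^sub>R b" "independent B" "span B = UNIV"
    "card B = (\<Sum>l\<in>eigenvalues A. dim (eigenspace A l))"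
proof -
  obtain Bs where "\<forall>l. Bs l \<subseteq> eigenspace A l \<and> pairwise orthogonal (Bs l) \<and> (\<forall>x\<in>Bs l. norm x = 1) \<and>
      independent (Bs l) \<and> card (Bs l) = dim (eigenspace A l) \<and> span (Bs l) = eigenspace A l"
    by (rule orthonormal_bases_family[of "eigenspace A", OF subspace_eigenspace])
  then have Bs: "\<And>l. Bs l \<subseteq> eigenspace A l" "\<And>l. pairwise orthogonal (Bs l)"
    "\<And>l x. x \<in> Bs l \<Longrightarrow> norm x = 1" "\<And>l. independent (Bs l)"
    "\<And>l. card (Bs l) = dim (eigenspace A l)" "\<And>l. span (Bs l) = eigenspace A l"
    by auto
  define B where "B = (\<Union>l\<in>eigenvalues A. Bs l)"
  have eig: "A *v b = l *\<^sub>R b" if "b \<in> Bs l" for b l using Bs(1) that by auto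
  have unit: "norm b = 1" if "b \<in> B" for b using that Bs(3) unfolding B_def by auto
  have orth: "pairwise orthogonal B"
    unfolding B_def by (rule pairwise_orthogonal_eigenbases_union[OF sym Bs(1,2)])
  have "0 \<notin> B" using unit by force
  with orth have ind: "independent B" by (rule pairwise_orthogonal_independent)
  have "eigenspace A l \<subseteq> span B" if "l \<in> eigenvalues A" for l
    unfolding Bs(6)[symmetric] B_def using that by (intro span_mono) blast
  then have "span (\<Union>l\<in>eigenvalues A. eigenspace A l) \<subseteq> span B" by (intro span_minimal) auto
  then have span: "span B = UNIV" using span_eigenspaces_symmetric[OF sym] by auto
  have disj: "Bs l \<inter> Bs m = {}" if "l \<noteq> m" for l m
  proof -
    have "Bs l \<inter> Bs m \<subseteq> {0}" using Bs(1)[of l] Bs(1)[of m] eigenspace_inter[OF that, of A] by blast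
    moreover have "0 \<notin> Bs l" using Bs(3)[of 0 l] by auto
    ultimately show ?thesis by blast
  qed
  have "card B = (\<Sum>l\<in>eigenvalues A. card (Bs l))" unfolding B_def
  proof (rule card_UN_disjoint)
    show "finite (eigenvalues A)" by (rule finite_eigenvalues[OF sym])
    show "\<forall>l\<in>eigenvalues A. finite (Bs l)" using Bs(4) finiteI_independent by blast
    show "\<forall>l\<in>eigenvalues A. \<forall>m\<in>eigenvalues A. l \<noteq> m \<longrightarrow> Bs l \<inter> Bs m = {}" using disj by blast
  qed
  then have card_B: "card B = (\<Sum>l\<in>eigenvalues A. dim (eigenspace A l))" using Bs(5) by simp
  have eigB: "A *v b = (b \<bullet> (A *v b)) *\<^sub>R b" if b: "b \<in> B" for b
  proof -
    obtain l where "b \<in> Bs l" using b unfolding B_def by blast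
    moreover have "b \<bullet> b = 1" using unit[OF b] by (simp add: norm_eq_1)
    ultimately show ?thesis using eig by simp
  qed
  show ?thesis by (rule that[OF orth _ _ ind span card_B]) (use unit eigB in blast)+
qed

lemma eigvals_mset_symmetric:
  fixes A :: "real^'n^'n"
  assumes sym: "transpose A = A"
  shows "set_mset (eigvals_mset A) = eigenvalues A" and "size (eigvals_mset A) = CARD('n)"
proof -
  have pos: "0 < dim (eigenspace A l) \<longleftrightarrow> l \<in> eigenvalues A" for l
  proof -
    have "0 < dim (eigenspace A l) \<longleftrightarrow> \<not> eigenspace A l \<subseteq> {0}"
      using dim_eq_0[of "eigenspace A l"] by linarith
    then show ?thesis unfolding eigenvalues_def by auto
  qed
  then have "finite {l. 0 < dim (eigenspace A l)}" using finite_eigenvalues[OF sym] by simp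
  then have count: "count (eigvals_mset A) = (\<lambda>l. dim (eigenspace A l))"
    unfolding eigvals_mset_def by (simp add: count_Abs_multiset)
  then show set: "set_mset (eigvals_mset A) = eigenvalues A"
    using pos by (auto simp flip: count_greater_zero_iff)
  obtain B :: "(real^'n) set" where "pairwise orthogonal B" "\<forall>b\<in>B. norm b = 1"
    "\<forall>b\<in>B. A *v b = (b \<bullet> (A *v b)) *\<^sub>R b" "independent B" "span B = UNIV"
    "card B = (\<Sum>l\<in>eigenvalues A. dim (eigenspace A l))"
    by (rule symmetric_orthonormal_eigenbasis[OF sym])
  then show "size (eigvals_mset A) = CARD('n)"
    by (simp add: size_multiset_overloaded_eq set count dim_span_eq_card_independent[symmetric])
qed

lemma sigma_min_eigenvalue:
  fixes A :: "real^'n^'n"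
  assumes sym: "transpose A = A"
  shows "sigma CARD('n) A \<in> eigenvalues A" and "l \<in> eigenvalues A \<Longrightarrow> sigma CARD('n) A \<le> l"
proof -
  define xs where "xs = sorted_list_of_multiset (eigvals_mset A)"
  have mset: "mset xs = eigvals_mset A" unfolding xs_def by simp
  have len: "length xs = CARD('n)"
    using eigvals_mset_symmetric(2)[OF sym] unfolding mset[symmetric] by simp
  have set: "set xs = eigenvalues A"
    using eigvals_mset_symmetric(1)[OF sym] unfolding mset[symmetric] by simp
  have sig: "sigma CARD('n) A = xs ! 0"
    unfolding sigma_def xs_def[symmetric] using len by (simp add: rev_nth)
  show "sigma CARD('n) A \<in> eigenvalues A" unfolding sig set[symmetric] using len by simp
  assume "l \<in> eigenvalues A"
  then obtain j where "j < length xs" "xs ! j = l" unfolding set[symmetric] by (auto simp: in_set_conv_nth)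
  moreover have "sorted xs" unfolding xs_def by simp
  ultimately show "sigma CARD('n) A \<le> l" unfolding sig using sorted_nth_mono[of xs 0] by fastforce
qed

lemma sigma_min_le_rayleigh:
  fixes A :: "real^'n^'n"
  assumes sym: "transpose A = A"
  shows "sigma CARD('n) A * (x \<bullet> x) \<le> x \<bullet> (A *v x)"
proof -
  have "(axis undefined 1 :: real^'n) \<noteq> 0" by (simp add: axis_eq_0_iff)
  then have ne: "(UNIV :: (real^'n) set) \<noteq> {0}" by blast
  obtain v \<mu> where "v \<in> UNIV" and v: "norm v = 1" "A *v v = \<mu> *\<^sub>R v"
    and rq: "\<forall>x\<in>UNIV. \<mu> * (x \<bullet> x) \<le> x \<bullet> (A *v x)"
    by (rule symmetric_min_eigenvector[OF sym subspace_UNIV _ ne]) simp_all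
  have "\<mu> \<in> eigenvalues A" unfolding eigenvalues_def using v by (intro CollectI exI[of _ v]) auto
  then have "sigma CARD('n) A * (x \<bullet> x) \<le> \<mu> * (x \<bullet> x)"
    by (intro mult_right_mono sigma_min_eigenvalue(2)[OF sym]) simp_all
  also have "\<dots> \<le> x \<bullet> (A *v x)" using rq by simp
  finally show ?thesis .
qed

lemma sigma_min_greatest:
  fixes A :: "real^'n^'n"
  assumes sym: "transpose A = A" and lb: "\<And>x. c * (x \<bullet> x) \<le> x \<bullet> (A *v x)"
  shows "c \<le> sigma CARD('n) A"
proof -
  obtain v where v: "v \<noteq> 0" "A *v v = sigma CARD('n) A *\<^sub>R v"
    using sigma_min_eigenvalue(1)[OF sym] unfolding eigenvalues_def by blast
  have "c * (v \<bullet> v) \<le> sigma CARD('n) A * (v \<bullet> v)" using lb[of v] v(2) by simp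
  then show ?thesis using v(1) by (simp add: mult_le_cancel_right)
qed

lemma sigma_min_pd_pos:
  fixes A :: "real^'n^'n"
  assumes pd: "pd A"
  shows "0 < sigma CARD('n) A"
proof -
  have sym: "transpose A = A" using pd unfolding pd_def by simp
  obtain v where v: "v \<noteq> 0" "A *v v = sigma CARD('n) A *\<^sub>R v"
    using sigma_min_eigenvalue(1)[OF sym] unfolding eigenvalues_def by blast
  have "0 < sigma CARD('n) A * (v \<bullet> v)" using pd v unfolding pd_def by force
  moreover have "0 < v \<bullet> v" using v(1) by simp
  ultimately show ?thesis by (simp add: zero_less_mult_iff)
qed

lemma psd_sqrt_on_eigenvector:
  fixes A P :: "real^'n^'n"
  assumes P: "psd P" and PP: "P ** P = A" and b: "A *v b = l *\<^sub>R b" and l: "0 \<le> l"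
  shows "P *v b = sqrt l *\<^sub>R b"
proof (cases "l = 0")
  case True
  have symP: "transpose P = P" using P unfolding psd_def by simp
  have "(P *v b) \<bullet> (P *v b) = b \<bullet> (A *v b)"
    using symmetric_inner_mulv[OF symP, of b "P *v b"] PP by (simp add: matrix_vector_mul_assoc)
  then show ?thesis using True b by simp
next
  case False
  define s where "s = sqrt l"
  have s: "0 < s" "s * s = l" using l False unfolding s_def by auto
  define u where "u = P *v b - s *\<^sub>R b"
  have "P *v u + s *\<^sub>R u = P *v (P *v b) - (s * s) *\<^sub>R b"
    unfolding u_def by (simp add: matrix_vector_mult_diff_distrib matrix_vector_mult_scaleR algebra_simps)
  also have "\<dots> = 0" using PP b s by (simp add: matrix_vector_mul_assoc)
  finally have "u \<bullet> (P *v u + s *\<^sub>R u) = 0" by simp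
  then have "u \<bullet> (P *v u) + s * (u \<bullet> u) = 0" by (simp add: inner_add_right)
  moreover have "0 \<le> u \<bullet> (P *v u)" using P unfolding psd_def by simp
  moreover have "0 \<le> u \<bullet> u" by simp
  ultimately have "u \<bullet> u = 0" using s(1) by (simp add: add_nonneg_eq_0_iff)
  then have "u = 0" by simp
  then show ?thesis unfolding u_def s_def by simp
qed

lemma psd_sqrt_ex1:
  fixes A :: "real^'n^'n"
  assumes A: "psd A"
  shows "\<exists>!R. psd R \<and> R ** R = A"
proof -
  have sym: "transpose A = A" using A unfolding psd_def by simp
  obtain B :: "(real^'n) set" where orth: "pairwise orthogonal B" and unit: "\<forall>b\<in>B. norm b = 1"
    and eig: "\<forall>b\<in>B. A *v b = (b \<bullet> (A *v b)) *\<^sub>R b" and ind: "independent B" and span: "span B = UNIV"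
    and "card B = (\<Sum>l\<in>eigenvalues A. dim (eigenspace A l))"
    by (rule symmetric_orthonormal_eigenbasis[OF sym])
  define lam where "lam b = b \<bullet> (A *v b)" for b
  have lam0: "0 \<le> lam b" for b using A unfolding psd_def lam_def by simp
  define R where "R = scatter_matrix (\<lambda>b. sqrt (lam b)) B"
  have Rc: "R *v c = sqrt (lam c) *\<^sub>R c" if "c \<in> B" for c
    unfolding R_def using finiteI_independent[OF ind] orth unit that by (rule scatter_matrix_orthonormal_mulv)
  have psdR: "psd R" unfolding R_def by (rule psd_scatter_matrix) (simp add: lam0)
  have RR: "R ** R = A"
  proof (rule matrix_eq_on_spanning[OF _ span])
    fix c assume c: "c \<in> B"
    have "(R ** R) *v c = (sqrt (lam c) * sqrt (lam c)) *\<^sub>R c"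
      using Rc[OF c] by (simp add: matrix_vector_mul_assoc[symmetric] matrix_vector_mult_scaleR)
    also have "\<dots> = A *v c" using eig[rule_format, OF c] lam0 unfolding lam_def by simp
    finally show "(R ** R) *v c = A *v c" .
  qed
  have "P = R" if "psd P" "P ** P = A" for P
  proof (rule matrix_eq_on_spanning[OF _ span])
    fix c assume c: "c \<in> B"
    have "P *v c = sqrt (lam c) *\<^sub>R c"
      by (rule psd_sqrt_on_eigenvector[OF that _ lam0]) (use eig[rule_format, OF c] lam_def in simp)
    then show "P *v c = R *v c" using Rc[OF c] by simp
  qed
  then show ?thesis using psdR RR by blast
qed

lemma psd_mat_sqrt: "psd A \<Longrightarrow> psd (mat_sqrt A)"
  and mat_sqrt_square: "psd A \<Longrightarrow> mat_sqrt A ** mat_sqrt A = A"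
  using theI'[OF psd_sqrt_ex1] unfolding mat_sqrt_def by blast+

lemma sqrt_inverse_congruence:
  fixes S R :: "real^'n^'n"
  assumes S: "invertible S" and RR: "R ** R = matrix_inv S"
  shows "R ** S ** R = mat 1"
proof -
  have "R ** (R ** S) = mat 1" using RR matrix_inv_left[OF S] by (simp add: matrix_mul_assoc)
  then show ?thesis using matrix_left_right_inverse by blast
qed

lemma sigma_min_congruence_le:
  fixes B S R :: "real^'n^'n"
  assumes B: "transpose B = B" and R: "transpose R = R" and S: "invertible S"
    and RR: "R ** R = matrix_inv S"
  shows "sigma CARD('n) (R ** B ** R) * (r \<bullet> (S *v r)) \<le> r \<bullet> (B *v r)"
proof -
  define t where "t = (R ** S) *v r"
  have Rt: "R *v t = r" unfolding t_def using RR matrix_inv_left[OF S]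
    by (simp add: matrix_vector_mul_assoc matrix_mul_assoc)
  have "t \<bullet> t = t \<bullet> ((transpose R ** S ** R) *v t)" using sqrt_inverse_congruence[OF S RR] R by simp
  also have "\<dots> = r \<bullet> (S *v r)" unfolding quad_form_congruence Rt ..
  finally have tt: "t \<bullet> t = r \<bullet> (S *v r)" .
  have "t \<bullet> ((R ** B ** R) *v t) = r \<bullet> (B *v r)"
    using quad_form_congruence[of t R B] R Rt by simp
  moreover have "transpose (R ** B ** R) = R ** B ** R"
    using B R by (simp add: matrix_transpose_mul matrix_mul_assoc)
  ultimately show ?thesis using sigma_min_le_rayleigh[of "R ** B ** R" t] tt by simp
qed

lemma pd_det_pos:
  fixes S :: "real^'n^'n"
  assumes "pd S"
  shows "0 < det S"
proof -
  define T where "T = mat_sqrt S"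
  have "det S = det T * det T"
    unfolding T_def using mat_sqrt_square[OF pd_imp_psd[OF assms]] det_mul by metis
  moreover have "det S \<noteq> 0"
    using det_mul[of S "matrix_inv S"] matrix_inv_right[OF pd_invertible[OF assms]] by auto
  ultimately show ?thesis by (metis mult_zero_left not_real_square_gt_zero)
qed

section \<open>Rank-one downdates\<close>

lemma det_identity_minus_rank_one:
  fixes v :: "real^'n"
  assumes v: "norm v = 1"
  shows "det (mat 1 - s *\<^sub>R outer v v) = 1 - s"
proof -
  obtain k :: 'n where True by blast
  obtain Q where Q: "orthogonal_matrix Q" "Q *v axis k 1 = v"
    using orthogonal_matrix_exists_basis[OF v] by blast
  define e :: "real^'n" where "e = axis k 1"
  define D where "D = mat 1 - s *\<^sub>R outer e e"
  have QQ: "transpose Q ** Q = mat 1" "Q ** transpose Q = mat 1"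
    using Q(1) unfolding orthogonal_matrix_def by auto
  have "Q ** D ** transpose Q = mat 1 - s *\<^sub>R (Q ** outer e e ** transpose Q)"
    unfolding D_def using QQ by (simp add: matrix_diff_ldistrib matrix_diff_rdistrib matrix_scalar_ac
        scalar_matrix_assoc[symmetric] matrix_mul_assoc)
  also have "Q ** outer e e ** transpose Q = outer v v"
    using outer_congruence[of "transpose Q" e e] Q(2) unfolding e_def by simp
  finally have eq: "mat 1 - s *\<^sub>R outer v v = Q ** D ** transpose Q" by simp
  have "det D = (\<Prod>i\<in>UNIV. D $ i $ i)"
    by (rule det_diagonal) (auto simp: D_def mat_def outer_def e_def axis_def)
  also have "\<dots> = (\<Prod>i\<in>UNIV. if i = k then 1 - s else 1)"
    by (rule prod.cong) (auto simp: D_def mat_def outer_def e_def axis_def)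
  finally have "det D = 1 - s" by simp
  moreover have "det Q * det (transpose Q) = 1" using QQ(2) det_mul[of Q "transpose Q"] by simp
  ultimately show ?thesis unfolding eq by (simp add: det_mul)
qed

lemma pd_rank_one_downdate:
  fixes S :: "real^'n^'n"
  assumes pd: "pd S" and b: "b \<bullet> (S *v b) = 1" and s: "0 \<le> s" "s < 1"
  shows "pd (S - s *\<^sub>R outer (S *v b) (S *v b))"
proof -
  have sym: "transpose S = S" using pd unfolding pd_def by simp
  have "0 < x \<bullet> ((S - s *\<^sub>R outer (S *v b) (S *v b)) *v x)" if "x \<noteq> 0" for x
  proof -
    have "(b \<bullet> (S *v x))\<^sup>2 \<le> x \<bullet> (S *v x)"
      using psd_cauchy_schwarz[OF pd_imp_psd[OF pd], of b x] b by simp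
    then have "s * (b \<bullet> (S *v x))\<^sup>2 \<le> s * (x \<bullet> (S *v x))" using s(1) by (rule mult_left_mono)
    moreover have "0 < (1 - s) * (x \<bullet> (S *v x))" using pd that s(2) unfolding pd_def by simp
    moreover have "x \<bullet> ((S - s *\<^sub>R outer (S *v b) (S *v b)) *v x) = x \<bullet> (S *v x) - s * (b \<bullet> (S *v x))\<^sup>2"
      using symmetric_inner_mulv[OF sym, of b x]
      by (simp add: matrix_vector_mult_diff_rdistrib scaleR_matrix_vector_assoc[symmetric] outer_mulv
          inner_diff_right power2_eq_square inner_commute)
    ultimately show ?thesis by (simp add: algebra_simps)
  qed
  moreover have "transpose (S - s *\<^sub>R outer (S *v b) (S *v b)) = S - s *\<^sub>R outer (S *v b) (S *v b)"
    using sym by (simp add: transpose_diff transpose_scalar transpose_outer)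
  ultimately show ?thesis unfolding pd_def by blast
qed

text \<open>Sherman--Morrison formula.\<close>

lemma matrix_inv_rank_one_downdate:
  fixes S :: "real^'n^'n"
  assumes pd: "pd S" and b: "b \<bullet> (S *v b) = 1" and s: "s < 1"
  shows "matrix_inv (S - s *\<^sub>R outer (S *v b) (S *v b)) = matrix_inv S + (s / (1 - s)) *\<^sub>R outer b b"
proof (rule matrix_inv_unique)
  have sym: "transpose S = S" using pd unfolding pd_def by simp
  define u where "u = s / (1 - s)"
  have u: "u - s - s * u = 0" unfolding u_def using s by (simp add: field_simps)
  have Sb: "(S *v b) \<bullet> (matrix_inv S *v w) = b \<bullet> w" for w
    using symmetric_inner_mulv[OF sym, of b "matrix_inv S *v w"] pd_matrix_inv_mulv[OF pd] by simp
  have bSb: "(S *v b) \<bullet> b = 1" using b by (simp add: inner_commute)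
  have "(S - s *\<^sub>R outer (S *v b) (S *v b)) *v ((matrix_inv S + u *\<^sub>R outer b b) *v w) = w" for w
  proof -
    have "(S - s *\<^sub>R outer (S *v b) (S *v b)) *v ((matrix_inv S + u *\<^sub>R outer b b) *v w)
        = w + ((b \<bullet> w) * (u - s - s * u)) *\<^sub>R (S *v b)"
      using Sb bSb pd_matrix_inv_mulv[OF pd]
      by (simp add: matrix_vector_mult_add_rdistrib matrix_vector_mult_diff_rdistrib matrix_vector_right_distrib
          scaleR_matrix_vector_assoc[symmetric] matrix_vector_mult_scaleR outer_mulv inner_add_right
          inner_scaleR_right algebra_simps)
    then show ?thesis using u by simp
  qed
  then show "(S - s *\<^sub>R outer (S *v b) (S *v b)) ** (matrix_inv S + (s / (1 - s)) *\<^sub>R outer b b) = mat 1"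
    unfolding u_def by (simp add: matrix_eq matrix_vector_mul_assoc[symmetric])
qed

lemma det_rank_one_downdate:
  fixes S :: "real^'n^'n"
  assumes pd: "pd S" and b: "b \<bullet> (S *v b) = 1"
  shows "det (S - s *\<^sub>R outer (S *v b) (S *v b)) = (1 - s) * det S"
proof -
  define T where "T = mat_sqrt S"
  have T: "T ** T = S" "transpose T = T"
    using mat_sqrt_square psd_mat_sqrt pd_imp_psd[OF pd] unfolding T_def psd_def by auto
  define v where "v = T *v b"
  have "v \<bullet> v = 1" unfolding v_def using symmetric_inner_mulv[OF T(2), of b "T *v b"] T(1) b
    by (simp add: matrix_vector_mul_assoc)
  then have v: "norm v = 1" by (simp add: norm_eq_1)
  have Tv: "T *v v = S *v b" unfolding v_def T(1)[symmetric] by (simp add: matrix_vector_mul_assoc)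
  have "outer (S *v b) (S *v b) = T ** outer v v ** T"
    using outer_congruence[of T v v] T(2) Tv by simp
  then have "S - s *\<^sub>R outer (S *v b) (S *v b) = T ** (mat 1 - s *\<^sub>R outer v v) ** T"
    using T(1) by (simp add: matrix_diff_ldistrib matrix_diff_rdistrib matrix_scalar_ac
        scalar_matrix_assoc[symmetric] matrix_mul_assoc)
  then show ?thesis
    using det_identity_minus_rank_one[OF v, of s] T(1)[symmetric] by (simp add: det_mul)
qed

section \<open>Tyler's M-estimator\<close>

lemma tme_obj_scaleR:
  fixes S :: "real^'d^'d" and Y :: "(real^'d) set"
  assumes pd: "pd S" and fin: "finite Y" and ne: "Y \<noteq> {}" and nz: "0 \<notin> Y" and c: "0 < c"
  shows "tme_obj Y (c *\<^sub>R S) = tme_obj Y S"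
proof -
  define n where "n = real (card Y)"
  have n: "0 < n" unfolding n_def using fin ne by (simp add: card_gt_0_iff)
  have "ln (y \<bullet> (matrix_inv (c *\<^sub>R S) *v y)) = ln (y \<bullet> (matrix_inv S *v y)) - ln c" if "y \<in> Y" for y
  proof -
    have "0 < y \<bullet> (matrix_inv S *v y)" using inv_quad_pos[OF pd] that nz by metis
    then show ?thesis using c
      by (simp add: matrix_inv_scaleR[OF pd_invertible[OF pd]] scaleR_matrix_vector_assoc[symmetric]
          ln_mult ln_div)
  qed
  then have "(\<Sum>y\<in>Y. ln (y \<bullet> (matrix_inv (c *\<^sub>R S) *v y)))
      = (\<Sum>y\<in>Y. ln (y \<bullet> (matrix_inv S *v y))) - n * ln c"
    by (simp add: sum_subtractf n_def)
  moreover have "ln (det (c *\<^sub>R S)) = real CARD('d) * ln c + ln (det S)"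
    using c pd_det_pos[OF pd] by (simp add: det_scaleR ln_mult ln_realpow)
  moreover have "real CARD('d) / n * (n * ln c) = real CARD('d) * ln c" using n by simp
  ultimately show ?thesis unfolding tme_obj_def n_def[symmetric] by (simp add: right_diff_distrib)
qed

lemma tme_obj_rank_one_downdate:
  fixes S :: "real^'d^'d" and Y :: "(real^'d) set"
  assumes pd: "pd S" and b: "b \<bullet> (S *v b) = 1" and s: "0 \<le> s" "s < 1" and nz: "0 \<notin> Y"
  shows "tme_obj Y (S - s *\<^sub>R outer (S *v b) (S *v b)) = tme_obj Y S
    + real CARD('d) / real (card Y)
      * (\<Sum>y\<in>Y. ln (1 + s / (1 - s) * ((b \<bullet> y)\<^sup>2 / (y \<bullet> (matrix_inv S *v y))))) + ln (1 - s)"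
proof -
  define q where "q y = y \<bullet> (matrix_inv S *v y)" for y
  define u where "u = s / (1 - s)"
  have u: "0 \<le> u" unfolding u_def using s by simp
  have "ln (y \<bullet> (matrix_inv (S - s *\<^sub>R outer (S *v b) (S *v b)) *v y)) = ln (q y) + ln (1 + u * ((b \<bullet> y)\<^sup>2 / q y))"
    if "y \<in> Y" for y
  proof -
    have q: "0 < q y" unfolding q_def using inv_quad_pos[OF pd] that nz by metis
    have "y \<bullet> (matrix_inv (S - s *\<^sub>R outer (S *v b) (S *v b)) *v y) = q y + u * (b \<bullet> y)\<^sup>2"
      unfolding matrix_inv_rank_one_downdate[OF pd b s(2)] q_def u_def
      by (simp add: matrix_vector_mult_add_rdistrib scaleR_matrix_vector_assoc[symmetric] outer_mulv
          inner_add_right power2_eq_square inner_commute)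
    also have "\<dots> = q y * (1 + u * ((b \<bullet> y)\<^sup>2 / q y))" using q by (simp add: field_simps)
    moreover have "0 < 1 + u * ((b \<bullet> y)\<^sup>2 / q y)" using q u by (simp add: add_pos_nonneg)
    ultimately show ?thesis using ln_mult_pos[OF q] by presburger
  qed
  then have "(\<Sum>y\<in>Y. ln (y \<bullet> (matrix_inv (S - s *\<^sub>R outer (S *v b) (S *v b)) *v y)))
      = (\<Sum>y\<in>Y. ln (q y)) + (\<Sum>y\<in>Y. ln (1 + u * ((b \<bullet> y)\<^sup>2 / q y)))"
    by (simp add: sum.distrib)
  moreover have "ln (det (S - s *\<^sub>R outer (S *v b) (S *v b))) = ln (1 - s) + ln (det S)"
    using s pd_det_pos[OF pd] by (simp add: det_rank_one_downdate[OF pd b] ln_mult)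
  ultimately show ?thesis unfolding tme_obj_def q_def u_def by (simp add: algebra_simps)
qed

lemma tme_le_rank_one_downdate:
  fixes S :: "real^'d^'d" and Y :: "(real^'d) set"
  assumes tme: "is_TME Y S" and b: "b \<bullet> (S *v b) = 1" and s: "0 \<le> s" "s < 1"
    and fin: "finite Y" and ne: "Y \<noteq> {}" and nz: "0 \<notin> Y"
  shows "tme_obj Y S \<le> tme_obj Y (S - s *\<^sub>R outer (S *v b) (S *v b))"
proof -
  have pd: "pd S" using tme unfolding is_TME_def by simp
  define S' where "S' = S - s *\<^sub>R outer (S *v b) (S *v b)"
  have pd': "pd S'" unfolding S'_def by (rule pd_rank_one_downdate[OF pd b s])
  define c where "c = real CARD('d) / trace S'"
  have c: "0 < c" unfolding c_def using pd_trace_pos[OF pd'] by simp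
  have "tme_obj Y S \<le> tme_obj Y (c *\<^sub>R S')"
    using tme pd_scaleR[OF pd' c] pd_trace_pos[OF pd'] unfolding is_TME_def c_def
    by (simp add: trace_scaleR)
  also have "\<dots> = tme_obj Y S'" by (rule tme_obj_scaleR[OF pd' fin ne nz c])
  finally show ?thesis unfolding S'_def .
qed

lemma ln_one_plus_le_linear_imp_ge_one:
  fixes \<alpha> :: real
  assumes "\<And>u. 0 < u \<Longrightarrow> ln (1 + u) \<le> \<alpha> * u"
  shows "1 \<le> \<alpha>"
proof (rule ccontr)
  assume "\<not> 1 \<le> \<alpha>"
  define u where "u = min 1 ((1 - \<alpha>) / 2)"
  have u: "0 < u" "u \<le> 1" "u < 1 - \<alpha>" using \<open>\<not> 1 \<le> \<alpha>\<close> unfolding u_def by (auto simp: min_def)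
  have "u - u\<^sup>2 \<le> ln (1 + u)" using ln_one_plus_pos_lower_bound[of u] u by simp
  also have "\<dots> \<le> \<alpha> * u" using assms u(1) by blast
  finally have "u * (1 - u - \<alpha>) \<le> 0" by (simp add: algebra_simps power2_eq_square)
  with u show False by (simp add: mult_le_0_iff)
qed

lemma tme_scatter_lower_bound:
  fixes Y :: "(real^'d) set" and S :: "real^'d^'d"
  assumes tme: "is_TME Y S" and fin: "finite Y" and ne: "Y \<noteq> {}" and nz: "0 \<notin> Y"
  shows "real (card Y) / real CARD('d) * (b \<bullet> (S *v b))
           \<le> (\<Sum>y\<in>Y. (b \<bullet> y)\<^sup>2 / (y \<bullet> (matrix_inv S *v y)))"
proof (cases "b = 0")
  case False
  have pd: "pd S" using tme unfolding is_TME_def by simp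
  define q where "q y = y \<bullet> (matrix_inv S *v y)" for y
  define K where "K c = (\<Sum>y\<in>Y. (c \<bullet> y)\<^sup>2 / q y)" for c
  define n where "n = real (card Y)"
  define d where "d = real CARD('d)"
  have n: "0 < n" unfolding n_def using fin ne by (simp add: card_gt_0_iff)
  have d: "0 < d" unfolding d_def by simp
  define \<beta> where "\<beta> = b \<bullet> (S *v b)"
  have \<beta>: "0 < \<beta>" unfolding \<beta>_def using pd False unfolding pd_def by blast
  define c where "c = (1 / sqrt \<beta>) *\<^sub>R b"
  have c: "c \<bullet> (S *v c) = 1"
    unfolding c_def using \<beta> by (simp add: matrix_vector_mult_scaleR \<beta>_def[symmetric] power2_eq_square[symmetric])
  have "ln (1 + u) \<le> (d / n * K c) * u" if u: "0 < u" for u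
  proof -
    define s where "s = u / (1 + u)"
    have s: "0 \<le> s" "s < 1" "s / (1 - s) = u" "1 - s = 1 / (1 + u)"
      unfolding s_def using u by (auto simp: field_simps)
    have "0 \<le> tme_obj Y (S - s *\<^sub>R outer (S *v c) (S *v c)) - tme_obj Y S"
      using tme_le_rank_one_downdate[OF tme c s(1,2) fin ne nz] by simp
    also have "\<dots> = d / n * (\<Sum>y\<in>Y. ln (1 + s / (1 - s) * ((c \<bullet> y)\<^sup>2 / q y))) + ln (1 - s)"
      unfolding tme_obj_rank_one_downdate[OF pd c s(1,2) nz] d_def n_def q_def by simp
    also have "\<dots> = d / n * (\<Sum>y\<in>Y. ln (1 + u * ((c \<bullet> y)\<^sup>2 / q y))) - ln (1 + u)"
      unfolding s(3) unfolding s(4) using u by (simp add: ln_div)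
    also have "\<dots> \<le> d / n * (u * K c) - ln (1 + u)"
      unfolding K_def sum_distrib_left using n d u
      by (intro diff_right_mono mult_left_mono sum_mono ln_add_one_self_le_self)
        (auto simp: q_def inv_quad_nonneg[OF pd])
    finally show ?thesis by (simp add: algebra_simps)
  qed
  then have "1 \<le> d / n * K c" by (rule ln_one_plus_le_linear_imp_ge_one)
  moreover have "K b = \<beta> * K c"
    unfolding K_def c_def using \<beta> by (simp add: sum_distrib_left power2_eq_square field_simps)
  ultimately show ?thesis unfolding K_def n_def[symmetric] d_def[symmetric] q_def \<beta>_def[symmetric]
    using n d \<beta> by (simp add: field_simps)
qed simp

lemma tme_whitened_scatter_lower_bound:
  fixes Y :: "(real^'d) set" and S R :: "real^'d^'d"
  assumes tme: "is_TME Y S" and fin: "finite Y" and ne: "Y \<noteq> {}" and nz: "0 \<notin> Y"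
    and R: "transpose R = R" and RR: "R ** R = matrix_inv S"
  shows "real (card Y) / real CARD('d) * (w \<bullet> w)
           \<le> (\<Sum>y\<in>Y. ((R *v w) \<bullet> y)\<^sup>2 / (y \<bullet> (matrix_inv S *v y)))"
proof -
  have "invertible S" using tme pd_invertible unfolding is_TME_def by blast
  then have "(R *v w) \<bullet> (S *v (R *v w)) = w \<bullet> w"
    using quad_form_congruence[of w R S] sqrt_inverse_congruence[OF _ RR] R by simp
  then show ?thesis using tme_scatter_lower_bound[OF tme fin ne nz, of "R *v w"] by simp
qed

section \<open>Reweighted scatter of inliers and outliers\<close>

lemma orthonormal_range_proj:
  fixes U :: "real^'d^'D"
  assumes U_on: "transpose U ** U = mat 1" and U_span: "range (\<lambda>v. U *v v) = L" and z: "z \<in> L"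
  shows "U *v (transpose U *v z) = z"
proof -
  obtain a where "z = U *v a" using z U_span by blast
  then show ?thesis using U_on by (simp add: matrix_vector_mul_assoc[of "transpose U"] del: transpose_matrix_vector)
qed

lemma inj_on_orthonormal_transpose:
  fixes U :: "real^'d^'D"
  assumes U_on: "transpose U ** U = mat 1" and U_span: "range (\<lambda>v. U *v v) = L"
  shows "inj_on (\<lambda>x. transpose U *v x) L"
proof (rule inj_onI)
  fix a b assume a: "a \<in> L" and b: "b \<in> L" and eq: "transpose U *v a = transpose U *v b"
  have "a = U *v (transpose U *v a)" by (rule orthonormal_range_proj[OF U_on U_span a, symmetric])
  also have "\<dots> = U *v (transpose U *v b)" by (simp only: eq)
  also have "\<dots> = b" by (rule orthonormal_range_proj[OF U_on U_span b])
  finally show "a = b" .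
qed

lemma orth_coord_nonzero:
  fixes Up :: "real^'k^'D"
  assumes L: "subspace L" and Up_span: "range (\<lambda>v. Up *v v) = orthogonal_comp L" and x: "x \<notin> L"
  shows "transpose Up *v x \<noteq> 0"
proof
  assume h: "transpose Up *v x = 0"
  have "orthogonal y x" if y: "y \<in> orthogonal_comp L" for y
  proof -
    obtain a where "y = Up *v a" using y Up_span by blast
    then show ?thesis unfolding orthogonal_def using h inner_transpose_mulv[of a Up x]
      by (simp del: transpose_matrix_vector)
  qed
  then have "x \<in> orthogonal_comp (orthogonal_comp L)" by (simp add: orthogonal_comp_def)
  then show False using orthogonal_comp_self[OF L] x by simp
qed

lemma quad_form_range_subspace:
  fixes U :: "real^'d^'D" and A :: "real^'D^'D"
  assumes U_on: "transpose U ** U = mat 1" and U_span: "range (\<lambda>v. U *v v) = L"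
    and sym: "transpose A = A" and im: "range (\<lambda>v. A *v v) \<subseteq> L"
  shows "p \<bullet> (A *v p) = (transpose U *v p) \<bullet> ((transpose U ** A ** U) *v (transpose U *v p))"
proof -
  define r where "r = transpose U *v p"
  have proj: "U *v (transpose U *v (A *v z)) = A *v z" for z
    using orthonormal_range_proj[OF U_on U_span] im by blast
  have "p \<bullet> (A *v p) = p \<bullet> (U *v (transpose U *v (A *v p)))" by (simp only: proj)
  also have "\<dots> = r \<bullet> (transpose U *v (A *v p))" unfolding r_def by (rule inner_mulv_transpose)
  also have "\<dots> = (A *v (U *v r)) \<bullet> p"
    by (simp only: inner_transpose_mulv symmetric_inner_mulv[OF sym])
  also have "\<dots> = p \<bullet> (U *v (transpose U *v (A *v (U *v r))))" by (simp only: proj inner_commute)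
  also have "\<dots> = r \<bullet> (transpose U *v (A *v (U *v r)))" unfolding r_def by (rule inner_mulv_transpose)
  also have "\<dots> = r \<bullet> ((transpose U ** A ** U) *v r)" by (simp only: matrix_vector_mul_assoc matrix_mul_assoc)
  finally show ?thesis unfolding r_def .
qed

lemma spec_norm_compression_pos:
  fixes Sig :: "real^'D^'D" and Up :: "real^'k^'D"
  assumes pd: "pd Sig" and Up_on: "transpose Up ** Up = mat 1"
  shows "0 < spec_norm (transpose Up ** Sig ** Up)"
proof -
  obtain i :: 'k where True by blast
  define g :: "real^'k" where "g = axis i 1"
  have "g \<noteq> 0" unfolding g_def by (simp add: axis_eq_0_iff)
  moreover have "transpose Up *v (Up *v g) = g" using Up_on by (simp add: matrix_vector_mul_assoc)
  ultimately have "Up *v g \<noteq> 0" by auto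
  then have "0 < (Up *v g) \<bullet> (Sig *v (Up *v g))" using pd unfolding pd_def by blast
  also have "\<dots> \<le> spec_norm (transpose Up ** Sig ** Up) * (g \<bullet> g)"
    unfolding quad_form_congruence[symmetric] by (rule quad_le_spec_norm)
  finally show ?thesis using \<open>g \<noteq> 0\<close> by (metis inner_gt_zero_iff zero_less_mult_pos2)
qed

lemma orth_coord_le_inv_quad:
  fixes Sig :: "real^'D^'D" and Up :: "real^'k^'D"
  assumes pd: "pd Sig" and Up_on: "transpose Up ** Up = mat 1"
  shows "(norm (transpose Up *v x))\<^sup>2 \<le> spec_norm (transpose Up ** Sig ** Up) * (x \<bullet> (matrix_inv Sig *v x))"
  unfolding power2_norm_eq_inner
  by (rule inv_quad_compression_ge[OF pd spec_norm_compression_pos[OF pd Up_on]])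
    (simp only: quad_form_congruence[symmetric] quad_le_spec_norm)

lemma inv_quad_le_sigma_min:
  fixes Sig :: "real^'D^'D"
  assumes pd: "pd Sig"
  shows "sigma CARD('D) Sig * (x \<bullet> (matrix_inv Sig *v x)) \<le> x \<bullet> x"
proof -
  define \<sigma> where "\<sigma> = sigma CARD('D) Sig"
  have \<sigma>: "0 < \<sigma>" unfolding \<sigma>_def by (rule sigma_min_pd_pos[OF pd])
  have pd\<sigma>: "pd (\<sigma> *\<^sub>R mat 1 :: real^'D^'D)"
    using \<sigma> unfolding pd_def by (simp add: transpose_scalar scaleR_matrix_vector_assoc[symmetric])
  have inv\<sigma>: "matrix_inv (\<sigma> *\<^sub>R mat 1 :: real^'D^'D) = (1 / \<sigma>) *\<^sub>R mat 1"
    using \<sigma> by (intro matrix_inv_unique) (simp add: matrix_scalar_ac scalar_matrix_assoc[symmetric])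
  have "\<sigma> * (p \<bullet> p) \<le> p \<bullet> (Sig *v p)" for p
    unfolding \<sigma>_def by (rule sigma_min_le_rayleigh) (use pd in \<open>simp add: pd_def\<close>)
  then have "(mat 1 *v x) \<bullet> (matrix_inv Sig *v (mat 1 *v x)) \<le> x \<bullet> (matrix_inv (\<sigma> *\<^sub>R mat 1) *v x)"
    by (intro inv_quad_compression_le[OF pd pd\<sigma>]) (simp add: scaleR_matrix_vector_assoc[symmetric])
  then show ?thesis unfolding \<sigma>_def[symmetric] inv\<sigma> using \<sigma>
    by (simp add: scaleR_matrix_vector_assoc[symmetric] field_simps)
qed

lemma inv_quad_le_on_subspace:
  fixes U :: "real^'d^'D" and Sig Sig1 :: "real^'D^'D" and S :: "real^'d^'d"
  assumes pd: "pd Sig" and le: "loewner_le Sig1 Sig" and sym1: "transpose Sig1 = Sig1"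
    and im: "range (\<lambda>v. Sig1 *v v) \<subseteq> L"
    and U_on: "transpose U ** U = mat 1" and U_span: "range (\<lambda>v. U *v v) = L"
    and pdS: "pd S" and dom: "\<And>r. r \<bullet> (S *v r) \<le> r \<bullet> ((transpose U ** Sig1 ** U) *v r)"
    and x: "x \<in> L"
  shows "x \<bullet> (matrix_inv Sig *v x) \<le> (transpose U *v x) \<bullet> (matrix_inv S *v (transpose U *v x))"
proof -
  have "(transpose U *v p) \<bullet> (S *v (transpose U *v p)) \<le> p \<bullet> (Sig *v p)" for p
  proof -
    have "(transpose U *v p) \<bullet> (S *v (transpose U *v p)) \<le> p \<bullet> (Sig1 *v p)"
      unfolding quad_form_range_subspace[OF U_on U_span sym1 im] by (rule dom)
    also have "\<dots> \<le> p \<bullet> (Sig *v p)"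
      using le unfolding loewner_le_def psd_def by (simp add: matrix_vector_mult_diff_rdistrib inner_diff_right)
    finally show ?thesis .
  qed
  from inv_quad_compression_le[OF pd pdS this, of "transpose U *v x"]
  show ?thesis unfolding orthonormal_range_proj[OF U_on U_span x] .
qed

lemma sigma_congruence_inv_quad_le:
  fixes U :: "real^'d^'D" and Sig Sig1 :: "real^'D^'D" and Sin R :: "real^'d^'d"
  assumes pd: "pd Sig" and le: "loewner_le Sig1 Sig" and sym1: "transpose Sig1 = Sig1"
    and im: "range (\<lambda>v. Sig1 *v v) \<subseteq> L"
    and U_on: "transpose U ** U = mat 1" and U_span: "range (\<lambda>v. U *v v) = L"
    and pdin: "pd Sin" and R: "transpose R = R" and RR: "R ** R = matrix_inv Sin"
    and pos: "0 < sigma CARD('d) (R ** (transpose U ** Sig1 ** U) ** R)" and x: "x \<in> L"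
  shows "sigma CARD('d) (R ** (transpose U ** Sig1 ** U) ** R) * (x \<bullet> (matrix_inv Sig *v x))
    \<le> (transpose U *v x) \<bullet> (matrix_inv Sin *v (transpose U *v x))"
proof -
  define \<mu> where "\<mu> = sigma CARD('d) (R ** (transpose U ** Sig1 ** U) ** R)"
  have symB: "transpose (transpose U ** Sig1 ** U) = transpose U ** Sig1 ** U"
    using sym1 by (simp add: matrix_transpose_mul matrix_mul_assoc)
  have "r \<bullet> ((\<mu> *\<^sub>R Sin) *v r) \<le> r \<bullet> ((transpose U ** Sig1 ** U) *v r)" for r
    using sigma_min_congruence_le[OF symB R pd_invertible[OF pdin] RR, of r]
    unfolding \<mu>_def by (simp add: scaleR_matrix_vector_assoc[symmetric])
  from inv_quad_le_on_subspace[OF pd le sym1 im U_on U_span pd_scaleR[OF pdin] this x]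
  show ?thesis
    using pos unfolding \<mu>_def[symmetric]
    by (simp add: matrix_inv_scaleR[OF pd_invertible[OF pdin]] scaleR_matrix_vector_assoc[symmetric] field_simps)
qed

lemma orthonormal_coords_nonzero:
  fixes U :: "real^'d^'D"
  assumes U_on: "transpose U ** U = mat 1" and U_span: "range (\<lambda>v. U *v v) = L" and nz: "0 \<notin> X"
  shows "0 \<notin> (\<lambda>x. transpose U *v x) ` (X \<inter> L)"
proof
  assume "0 \<in> (\<lambda>x. transpose U *v x) ` (X \<inter> L)"
  then obtain x where x: "x \<in> X \<inter> L" "0 = transpose U *v x" by (rule imageE)
  then have "x = 0" using orthonormal_range_proj[OF U_on U_span, of x] by (metis IntD2 matrix_vector_mult_0_right)
  then show False using x nz by blast
qed

lemma tme_inlier_quad_ge: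
  fixes X L :: "(real^'D) set" and U :: "real^'d^'D" and Sin R :: "real^'d^'d"
    and Sig Sig1 :: "real^'D^'D"
  assumes finX: "finite X" and nz: "0 \<notin> X"
    and U_on: "transpose U ** U = mat 1" and U_span: "range (\<lambda>v. U *v v) = L"
    and ne: "X \<inter> L \<noteq> {}" and tme: "is_TME ((\<lambda>x. transpose U *v x) ` (X \<inter> L)) Sin"
    and pd: "pd Sig" and le: "loewner_le Sig1 Sig" and sym1: "transpose Sig1 = Sig1"
    and im: "range (\<lambda>v. Sig1 *v v) \<subseteq> L"
    and R: "transpose R = R" and RR: "R ** R = matrix_inv Sin"
    and pos: "0 < sigma CARD('d) (R ** (transpose U ** Sig1 ** U) ** R)"
  shows "real (card (X \<inter> L)) / real CARD('d) * sigma CARD('d) (R ** (transpose U ** Sig1 ** U) ** R) * (w \<bullet> w)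
    \<le> (\<Sum>x\<in>X \<inter> L. ((R *v w) \<bullet> (transpose U *v x))\<^sup>2 / (x \<bullet> (matrix_inv Sig *v x)))"
    (is "?n / ?d * ?\<mu> * _ \<le> _")
proof -
  define q where "q x = x \<bullet> (matrix_inv Sig *v x)" for x
  define qin where "qin y = y \<bullet> (matrix_inv Sin *v y)" for y
  define Y where "Y = (\<lambda>x. transpose U *v x) ` (X \<inter> L)"
  have pdin: "pd Sin" using tme unfolding is_TME_def by simp
  have inj: "inj_on (\<lambda>x. transpose U *v x) (X \<inter> L)"
    using inj_on_orthonormal_transpose[OF U_on U_span] by (rule inj_on_subset) simp
  have weight: "?\<mu> * (a / qin (transpose U *v x)) \<le> a / q x" if x: "x \<in> X \<inter> L" and a: "0 \<le> a" for x a
  proof -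
    have mu_q: "?\<mu> * q x \<le> qin (transpose U *v x)"
      using sigma_congruence_inv_quad_le[OF pd le sym1 im U_on U_span pdin R RR pos IntD2[OF x]]
      unfolding q_def qin_def .
    have "x \<noteq> 0" using x nz by blast
    then have "0 < q x" unfolding q_def by (rule inv_quad_pos[OF pd])
    then have "0 < ?\<mu> * q x" using pos by simp
    then have "a / qin (transpose U *v x) \<le> a / (?\<mu> * q x)"
      using mu_q a by (intro divide_left_mono) auto
    then have "?\<mu> * (a / qin (transpose U *v x)) \<le> ?\<mu> * (a / (?\<mu> * q x))"
      using pos by (intro mult_left_mono) simp_all
    also have "\<dots> = a / q x" using pos by simp
    finally show ?thesis .
  qed
  have "?n / ?d * (w \<bullet> w) \<le> (\<Sum>y\<in>Y. ((R *v w) \<bullet> y)\<^sup>2 / qin y)"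
    using tme_whitened_scatter_lower_bound[OF tme _ _ _ R RR, of w] finX ne card_image[OF inj]
      orthonormal_coords_nonzero[OF U_on U_span nz]
    unfolding Y_def qin_def by simp
  also have "\<dots> = (\<Sum>x\<in>X \<inter> L. ((R *v w) \<bullet> (transpose U *v x))\<^sup>2 / qin (transpose U *v x))"
    unfolding Y_def sum.reindex[OF inj] comp_def ..
  finally have "?\<mu> * (?n / ?d * (w \<bullet> w))
      \<le> ?\<mu> * (\<Sum>x\<in>X \<inter> L. ((R *v w) \<bullet> (transpose U *v x))\<^sup>2 / qin (transpose U *v x))"
    using pos by (intro mult_left_mono) simp_all
  also have "\<dots> \<le> (\<Sum>x\<in>X \<inter> L. ((R *v w) \<bullet> (transpose U *v x))\<^sup>2 / q x)"
    unfolding sum_distrib_left using weight by (intro sum_mono) simp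
  finally show ?thesis unfolding q_def by (simp add: mult_ac)
qed

lemma tme_sigma_min_scatter_ge:
  fixes X L :: "(real^'D) set" and U :: "real^'d^'D" and Sin R :: "real^'d^'d"
    and Sig Sig1 :: "real^'D^'D"
  assumes finX: "finite X" and nz: "0 \<notin> X"
    and U_on: "transpose U ** U = mat 1" and U_span: "range (\<lambda>v. U *v v) = L"
    and ne: "X \<inter> L \<noteq> {}" and tme: "is_TME ((\<lambda>x. transpose U *v x) ` (X \<inter> L)) Sin"
    and pd: "pd Sig" and le: "loewner_le Sig1 Sig" and sym1: "transpose Sig1 = Sig1"
    and im: "range (\<lambda>v. Sig1 *v v) \<subseteq> L"
    and R: "transpose R = R" and RR: "R ** R = matrix_inv Sin"
  shows "real (card (X \<inter> L)) / real CARD('d) * sigma CARD('d) (R ** (transpose U ** Sig1 ** U) ** R)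
    \<le> sigma CARD('d)
         (R ** (transpose U ** scatter_matrix (\<lambda>x. 1 / (x \<bullet> (matrix_inv Sig *v x))) (X \<inter> L) ** U) ** R)"
    (is "?n / ?d * ?\<mu> \<le> sigma _ ?M")
proof -
  have M: "?M = transpose (U ** R) ** scatter_matrix (\<lambda>x. 1 / (x \<bullet> (matrix_inv Sig *v x))) (X \<inter> L) ** (U ** R)"
    using R by (simp add: matrix_transpose_mul matrix_mul_assoc)
  have quadM: "w \<bullet> (?M *v w)
      = (\<Sum>x\<in>X \<inter> L. ((R *v w) \<bullet> (transpose U *v x))\<^sup>2 / (x \<bullet> (matrix_inv Sig *v x)))" for w
    unfolding M quad_congruence_scatter_matrix
    by (simp add: matrix_vector_mul_assoc[symmetric] inner_transpose_mulv[symmetric] del: transpose_matrix_vector)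
  have "?n / ?d * ?\<mu> * (w \<bullet> w) \<le> w \<bullet> (?M *v w)" for w
  proof (cases "?\<mu> \<le> 0")
    case True
    then have "?n / ?d * ?\<mu> * (w \<bullet> w) \<le> 0" by (intro mult_nonpos_nonneg mult_nonneg_nonpos) simp_all
    also have "\<dots> \<le> w \<bullet> (?M *v w)" unfolding quadM by (intro sum_nonneg) (simp add: inv_quad_nonneg[OF pd])
    finally show ?thesis .
  next
    case False
    then show ?thesis unfolding quadM
      by (intro tme_inlier_quad_ge[OF finX nz U_on U_span ne tme pd le sym1 im R RR]) simp
  qed
  moreover have "transpose ?M = ?M"
    using R by (simp add: matrix_transpose_mul matrix_mul_assoc transpose_scatter_matrix)
  ultimately show ?thesis by (intro sigma_min_greatest) simp_all
qed

lemma scatter_inv_quad_le_orth: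
  fixes Up :: "real^'k^'D" and Sig :: "real^'D^'D"
  assumes pd: "pd Sig" and Up_on: "transpose Up ** Up = mat 1" and L: "subspace L"
    and Up_span: "range (\<lambda>v. Up *v v) = orthogonal_comp L" and S: "S \<inter> L = {}"
  shows "loewner_le (scatter_matrix (\<lambda>x. 1 / (x \<bullet> (matrix_inv Sig *v x))) S)
    (spec_norm (transpose Up ** Sig ** Up) *\<^sub>R scatter_matrix (\<lambda>x. 1 / (norm (transpose Up *v x))\<^sup>2) S)"
  unfolding scaleR_scatter_matrix
proof (rule scatter_matrix_mono)
  fix x assume "x \<in> S"
  then have "x \<notin> L" using S by blast
  then have g: "0 < (norm (transpose Up *v x))\<^sup>2" using orth_coord_nonzero[OF L Up_span] by simp
  then have "0 < x \<bullet> (matrix_inv Sig *v x)"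
    using inv_quad_pos[OF pd] \<open>x \<notin> L\<close> subspace_0[OF L] by (metis matrix_vector_mult_0_right)
  with g orth_coord_le_inv_quad[OF pd Up_on, of x]
  show "1 / (x \<bullet> (matrix_inv Sig *v x))
      \<le> spec_norm (transpose Up ** Sig ** Up) * (1 / (norm (transpose Up *v x))\<^sup>2)"
    by (simp add: field_simps)
qed

lemma trace_orth_scatter_inv_quad_le:
  fixes Up :: "real^'k^'D" and Sig :: "real^'D^'D"
  assumes pd: "pd Sig" and Up_on: "transpose Up ** Up = mat 1"
  shows "trace (transpose Up ** scatter_matrix (\<lambda>x. 1 / (x \<bullet> (matrix_inv Sig *v x))) S ** Up)
    \<le> real (card S) * spec_norm (transpose Up ** Sig ** Up)"
proof -
  have "1 / (x \<bullet> (matrix_inv Sig *v x)) * (norm (transpose Up *v x))\<^sup>2 \<le> spec_norm (transpose Up ** Sig ** Up)"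
    for x
    using orth_coord_le_inv_quad[OF pd Up_on, of x] inv_quad_nonneg[OF pd, of x] spec_norm_nonneg
    by (cases "x \<bullet> (matrix_inv Sig *v x) = 0") (simp_all add: field_simps)
  then show ?thesis unfolding trace_congruence_scatter_matrix by (rule sum_bounded_above)
qed

lemma sigma_min_scatter_le_scatter_inv_quad:
  fixes Sig :: "real^'D^'D"
  assumes pd: "pd Sig"
  shows "loewner_le (sigma CARD('D) Sig *\<^sub>R scatter_matrix (\<lambda>x. 1 / (norm x)\<^sup>2) S)
    (scatter_matrix (\<lambda>x. 1 / (x \<bullet> (matrix_inv Sig *v x))) S)"
  unfolding scaleR_scatter_matrix
proof (rule scatter_matrix_mono)
  fix x :: "real^'D"
  show "sigma CARD('D) Sig * (1 / (norm x)\<^sup>2) \<le> 1 / (x \<bullet> (matrix_inv Sig *v x))"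
  proof (cases "x = 0")
    case False
    then show ?thesis using inv_quad_le_sigma_min[OF pd, of x] inv_quad_pos[OF pd False]
      by (simp add: field_simps power2_norm_eq_inner)
  qed simp
qed

theorem lemma1:
  fixes X :: "(real^'D) set" and L :: "(real^'D) set"
    and U :: "real^'d^'D" and Up :: "real^'k^'D"
    and Sin :: "real^'d^'d"
    and Sig Sig1 Sig2 :: "real^'D^'D"
  assumes finX: "finite X" and nz: "0 \<notin> X"
    and subL: "subspace L" and dimL: "dim L = CARD('d)" and dlt: "CARD('d) < CARD('D)"
    and U_on: "transpose U ** U = mat 1" and U_span: "range (\<lambda>v. U *v v) = L"
    and Up_on: "transpose Up ** Up = mat 1" and Up_span: "range (\<lambda>v. Up *v v) = orthogonal_comp L"
    and n1pos: "X \<inter> L \<noteq> {}"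
    and tme: "is_TME ((\<lambda>x. transpose U *v x) ` (X \<inter> L)) Sin"
    and Sig_pd: "pd Sig" and Sig_dec: "Sig = Sig1 + Sig2"
    and Sig1_psd: "psd Sig1" and Sig2_psd: "psd Sig2"
    and Sig1_im: "range (\<lambda>v. Sig1 *v v) \<subseteq> L"
  defines "Xin \<equiv> X \<inter> L"
    and "Xout \<equiv> X - X \<inter> L"
    and "Splus_in \<equiv> (\<Sum>x\<in>X \<inter> L. (1 / (x \<bullet> (matrix_inv Sig *v x))) *\<^sub>R outer x x)"
    and "Splus_out \<equiv> (\<Sum>x\<in>X - X \<inter> L. (1 / (x \<bullet> (matrix_inv Sig *v x))) *\<^sub>R outer x x)"
    and "h \<equiv> (\<lambda>M. sigma CARD('d) (mat_sqrt (matrix_inv Sin) ** (transpose U ** M ** U)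
                                     ** mat_sqrt (matrix_inv Sin)))"
    and "c \<equiv> spec_norm (transpose Up ** Sig ** Up)"
    and "Aout \<equiv> spec_norm (\<Sum>x\<in>X - X \<inter> L. (1 / (norm (transpose Up *v x))\<^sup>2) *\<^sub>R outer x x)"
  shows "h Splus_in \<ge> real (card Xin) / real CARD('d) * h Sig1 \<and>
         loewner_le Splus_out
           (c *\<^sub>R (\<Sum>x\<in>Xout. (1 / (norm (transpose Up *v x))\<^sup>2) *\<^sub>R outer x x)) \<and>
         spec_norm Splus_out \<le> Aout * c \<and>
         trace (transpose Up ** Splus_out ** Up) \<le> real (card Xout) * c \<and>
         loewner_le (sigma CARD('D) Sig *\<^sub>R (\<Sum>x\<in>Xout. (1 / (norm x)\<^sup>2) *\<^sub>R outer x x)) Splus_out \<and>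
         loewner_le (sigma CARD('D) Sig *\<^sub>R (\<Sum>x\<in>X. (1 / (norm x)\<^sup>2) *\<^sub>R outer x x))
           (Splus_in + Splus_out)"
proof -
  let ?w = "\<lambda>x. 1 / (x \<bullet> (matrix_inv Sig *v x))"
  let ?g = "\<lambda>x. 1 / (norm (transpose Up *v x))\<^sup>2"
  have Splus_in: "Splus_in = scatter_matrix ?w Xin" and Splus_out: "Splus_out = scatter_matrix ?w Xout"
    unfolding Splus_in_def Splus_out_def Xin_def Xout_def scatter_matrix_def by simp_all
  have Aout: "Aout = spec_norm (scatter_matrix ?g Xout)"
    unfolding Aout_def Xout_def scatter_matrix_def by simp
  have R: "psd (mat_sqrt (matrix_inv Sin))" "mat_sqrt (matrix_inv Sin) ** mat_sqrt (matrix_inv Sin) = matrix_inv Sin"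
    using tme psd_matrix_inv psd_mat_sqrt mat_sqrt_square unfolding is_TME_def by blast+
  have "loewner_le Sig1 Sig" unfolding loewner_le_def Sig_dec using Sig2_psd by simp
  then have i: "real (card Xin) / real CARD('d) * h Sig1 \<le> h Splus_in"
    unfolding h_def Splus_in Xin_def using Sig1_psd R(1) unfolding psd_def
    by (intro tme_sigma_min_scatter_ge[OF finX nz U_on U_span n1pos tme Sig_pd _ _ Sig1_im _ R(2)]) simp_all
  have ii: "loewner_le Splus_out (c *\<^sub>R scatter_matrix ?g Xout)"
    unfolding Splus_out c_def by (rule scatter_inv_quad_le_orth[OF Sig_pd Up_on subL Up_span]) (auto simp: Xout_def)
  have "spec_norm Splus_out \<le> spec_norm (c *\<^sub>R scatter_matrix ?g Xout)"
    using ii unfolding Splus_out by (intro spec_norm_mono psd_scatter_matrix) (simp add: inv_quad_nonneg[OF Sig_pd])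
  then have spec: "spec_norm Splus_out \<le> Aout * c"
    unfolding spec_norm_scaleR Aout c_def by (simp add: spec_norm_nonneg mult.commute)
  have iii: "trace (transpose Up ** Splus_out ** Up) \<le> real (card Xout) * c"
    unfolding Splus_out c_def by (rule trace_orth_scatter_inv_quad_le[OF Sig_pd Up_on])
  have "X = Xin \<union> Xout" "Xin \<inter> Xout = {}" unfolding Xin_def Xout_def by auto
  then have "Splus_in + Splus_out = scatter_matrix ?w X"
    unfolding Splus_in Splus_out using finX by (simp add: scatter_matrix_union)
  then show ?thesis
    using i ii spec iii sigma_min_scatter_le_scatter_inv_quad[OF Sig_pd, of Xout]
      sigma_min_scatter_le_scatter_inv_quad[OF Sig_pd, of X]
    unfolding Splus_out scatter_matrix_def by simp
qed

end
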